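(* Let $\Bbbk$ be a field of characteristic $0$, and let $\lambda_0,\lambda_1:U(W_+)\to R$ be as in the context. Then $\ker\lambda_0=\ker\lambda_1=(e_1e_3-e_2^2-e_4)$, and this ideal is not finitely generated as a left ideal of $U(W_+)$ and is not finitely generated as a right ideal of $U(W_+)$.
   Context: The positive Witt algebra $W_+$ is the Lie algebra over $\Bbbk$ with basis $\{e_n\}_{n\geq 1}$ and bracket $[e_n,e_m]=(m-n)e_{n+m}$; $U(W_+)$ is its universal enveloping algebra. $R$ (the Jordan plane) is the $\Bbbk$-algebra generated by $u,v$ subject to $uv-vu-v^2=0$. For $a\in\Bbbk$, $\lambda_a: U(W_+)\to R$ is the (well-defined) algebra homomorphism with $\lambda_a(e_n)=(u-(n-1)av)v^{n-1}$ for all $n\ge 1$. $(r)$ denotes the two-sided ideal generated by $r$. *)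

theory Defs
  imports Complex_Main "HOL-Library.Poly_Mapping"
begin

section \<open>Ideals and algebras\<close>

definition two_sided_ideal :: "'a::ring_1 set \<Rightarrow> bool" where
  "two_sided_ideal I \<longleftrightarrow> 0 \<in> I \<and> (\<forall>x\<in>I. \<forall>y\<in>I. x + y \<in> I) \<and> (\<forall>x\<in>I. \<forall>a. a * x \<in> I \<and> x * a \<in> I)"

definition left_ideal :: "'a::ring_1 set \<Rightarrow> bool" where
  "left_ideal I \<longleftrightarrow> 0 \<in> I \<and> (\<forall>x\<in>I. \<forall>y\<in>I. x + y \<in> I) \<and> (\<forall>x\<in>I. \<forall>a. a * x \<in> I)"

definition right_ideal :: "'a::ring_1 set \<Rightarrow> bool" where
  "right_ideal I \<longleftrightarrow> 0 \<in> I \<and> (\<forall>x\<in>I. \<forall>y\<in>I. x + y \<in> I) \<and> (\<forall>x\<in>I. \<forall>a. x * a \<in> I)"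

definition fg_left_ideal :: "'a::ring_1 set \<Rightarrow> bool" where
  "fg_left_ideal I \<longleftrightarrow> (\<exists>S. finite S \<and> I = left_ideal hull S)"

definition fg_right_ideal :: "'a::ring_1 set \<Rightarrow> bool" where
  "fg_right_ideal I \<longleftrightarrow> (\<exists>S. finite S \<and> I = right_ideal hull S)"

lemma two_sided_ideal_hull: "two_sided_ideal (two_sided_ideal hull S)"
  by (rule hull_in) (auto simp: two_sided_ideal_def)

lemma two_sided_ideal_0: "two_sided_ideal I \<Longrightarrow> 0 \<in> I"
  and two_sided_ideal_add: "two_sided_ideal I \<Longrightarrow> x \<in> I \<Longrightarrow> y \<in> I \<Longrightarrow> x + y \<in> I"
  and two_sided_ideal_mult_left: "two_sided_ideal I \<Longrightarrow> x \<in> I \<Longrightarrow> a * x \<in> I"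
  and two_sided_ideal_mult_right: "two_sided_ideal I \<Longrightarrow> x \<in> I \<Longrightarrow> x * a \<in> I"
  by (auto simp: two_sided_ideal_def)

lemma two_sided_ideal_uminus: "two_sided_ideal I \<Longrightarrow> x \<in> I \<Longrightarrow> - x \<in> I"
  using two_sided_ideal_mult_left[of I x "-1"] by simp

lemma two_sided_ideal_diff: "two_sided_ideal I \<Longrightarrow> x \<in> I \<Longrightarrow> y \<in> I \<Longrightarrow> x - y \<in> I"
  using two_sided_ideal_add[of I x "-y"] two_sided_ideal_uminus[of I y] by simp

lemma equivp_ideal:
  assumes "two_sided_ideal I" shows "equivp (\<lambda>x y. x - y \<in> I)"
proof (rule equivpI)
  show "reflp (\<lambda>x y. x - y \<in> I)" using two_sided_ideal_0[OF assms] by (simp add: reflp_def)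
  show "symp (\<lambda>x y. x - y \<in> I)"
    using two_sided_ideal_uminus[OF assms] by (metis minus_diff_eq sympI)
  show "transp (\<lambda>x y. x - y \<in> I)"
  proof (rule transpI)
    fix x y z assume "x - y \<in> I" "y - z \<in> I"
    from two_sided_ideal_add[OF assms this] show "x - z \<in> I" by simp
  qed
qed

lemma ideal_cong:
  assumes "two_sided_ideal I" "x - x' \<in> I" "y - y' \<in> I"
  shows "(x + y) - (x' + y') \<in> I" "(x - y) - (x' - y') \<in> I" "x * y - x' * y' \<in> I" "- x - - x' \<in> I"
proof -
  have e: "(x + y) - (x' + y') = (x - x') + (y - y')" "(x - y) - (x' - y') = (x - x') - (y - y')"
    "x * y - x' * y' = (x - x') * y + x' * (y - y')" "- x - - x' = - (x - x')"
    by (simp_all add: algebra_simps)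
  show "(x + y) - (x' + y') \<in> I" "(x - y) - (x' - y') \<in> I" "x * y - x' * y' \<in> I" "- x - - x' \<in> I"
    unfolding e using assms by (auto intro: two_sided_ideal_add two_sided_ideal_diff
        two_sided_ideal_mult_left two_sided_ideal_mult_right two_sided_ideal_uminus
        simp del: minus_diff_eq)
qed

locale k_algebra = vector_space scale for scale :: "'k::field \<Rightarrow> 'a::ring_1 \<Rightarrow> 'a" +
  assumes scale_mult_left: "scale c x * y = scale c (x * y)"
    and scale_mult_right: "x * scale c y = scale c (x * y)"

definition algebra_hom :: "('k::field \<Rightarrow> 'a::ring_1 \<Rightarrow> 'a) \<Rightarrow> ('k \<Rightarrow> 'b::ring_1 \<Rightarrow> 'b) \<Rightarrow> ('a \<Rightarrow> 'b) \<Rightarrow> bool" where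
  "algebra_hom sA sB h \<longleftrightarrow> Vector_Spaces.linear sA sB h \<and> (\<forall>x y. h (x * y) = h x * h y) \<and> h 1 = 1"

locale lie_algebra = vector_space scale for scale :: "'k::field \<Rightarrow> 'l::ab_group_add \<Rightarrow> 'l" +
  fixes bracket :: "'l \<Rightarrow> 'l \<Rightarrow> 'l"
  assumes bracket_add_left: "bracket (x + y) z = bracket x z + bracket y z"
    and bracket_add_right: "bracket z (x + y) = bracket z x + bracket z y"
    and bracket_scale_left: "bracket (scale c x) y = scale c (bracket x y)"
    and bracket_scale_right: "bracket x (scale c y) = scale c (bracket x y)"
    and bracket_self: "bracket x x = 0"
    and jacobi: "bracket x (bracket y z) + bracket y (bracket z x) + bracket z (bracket x y) = 0"


section \<open>Free vector spaces and free algebras\<close>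

definition pm_scale :: "'k \<Rightarrow> ('x \<Rightarrow>\<^sub>0 'k) \<Rightarrow> ('x \<Rightarrow>\<^sub>0 'k::field)" where
  "pm_scale c p = Poly_Mapping.map ((*) c) p"

lemma lookup_pm_scale [simp]: "Poly_Mapping.lookup (pm_scale c p) x = c * Poly_Mapping.lookup p x"
  unfolding pm_scale_def by (auto simp: Poly_Mapping.map.rep_eq when_def)

lemma pm_scale_single [simp]: "pm_scale c (Poly_Mapping.single x d) = Poly_Mapping.single x (c * d)"
  by (rule poly_mapping_eqI) (auto simp: lookup_single when_def)

interpretation pm: vector_space pm_scale
  by unfold_locales (auto intro!: poly_mapping_eqI simp: lookup_add algebra_simps)

lemma pm_induct:
  fixes p :: "'x \<Rightarrow>\<^sub>0 'k::field"
  assumes "P 0" "\<And>x c. P (Poly_Mapping.single x c)" "\<And>p q. P p \<Longrightarrow> P q \<Longrightarrow> P (p + q)"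
  shows "P p"
proof (induction p rule: update_induct)
  case const
  show ?case by (rule assms)
next
  case (update f a b)
  have "Poly_Mapping.update a b f = f + Poly_Mapping.single a b"
    using update(1) by (intro poly_mapping_eqI)
      (auto simp: lookup_update lookup_add lookup_single when_def in_keys_iff)
  then show ?case using assms update by metis
qed

text \<open>The linear map on the free vector space over \<open>'x\<close> that extends \<open>f\<close>.\<close>

definition lin_ext :: "('k::field \<Rightarrow> 'b::ab_group_add \<Rightarrow> 'b) \<Rightarrow> ('x \<Rightarrow> 'b) \<Rightarrow> ('x \<Rightarrow>\<^sub>0 'k) \<Rightarrow> 'b" where
  "lin_ext s f p = (\<Sum>x\<in>Poly_Mapping.keys p. s (Poly_Mapping.lookup p x) (f x))"

context vector_space
begin

lemma lin_ext_superset: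
  assumes "finite A" "Poly_Mapping.keys p \<subseteq> A"
  shows "lin_ext scale f p = (\<Sum>x\<in>A. scale (Poly_Mapping.lookup p x) (f x))"
  unfolding lin_ext_def using assms
  by (intro sum.mono_neutral_left) (auto simp: in_keys_iff)

lemma lin_ext_add: "lin_ext scale f (p + q) = lin_ext scale f p + lin_ext scale f q"
proof -
  let ?A = "Poly_Mapping.keys p \<union> Poly_Mapping.keys q"
  have "Poly_Mapping.keys (p + q) \<subseteq> ?A" by (rule Poly_Mapping.keys_add)
  then show ?thesis
    by (simp add: lin_ext_superset[of ?A] lookup_add scale_left_distrib sum.distrib)
qed

lemma lin_ext_scale: "lin_ext scale f (pm_scale c p) = scale c (lin_ext scale f p)"
proof -
  have "Poly_Mapping.keys (pm_scale c p) \<subseteq> Poly_Mapping.keys p" by (auto simp: in_keys_iff)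
  then show ?thesis
    by (simp add: lin_ext_superset[of "Poly_Mapping.keys p"] scale_sum_right)
qed

lemma lin_ext_single [simp]: "lin_ext scale f (Poly_Mapping.single x c) = scale c (f x)"
  by (cases "c = 0") (simp_all add: lin_ext_def)

lemma lin_ext_0 [simp]: "lin_ext scale f 0 = 0"
  by (simp add: lin_ext_def)

lemma lin_ext_fun_add: "lin_ext scale (\<lambda>x. f x + g x) p = lin_ext scale f p + lin_ext scale g p"
  by (simp add: lin_ext_def scale_right_distrib sum.distrib)

lemma lin_ext_fun_scale: "lin_ext scale (\<lambda>x. scale c (f x)) p = scale c (lin_ext scale f p)"
  by (simp add: lin_ext_def scale_sum_right mult.commute)

lemma lin_ext_linear: "Vector_Spaces.linear pm_scale scale (lin_ext scale f)"
  by unfold_locales (auto simp: lin_ext_add lin_ext_scale)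

end

text \<open>The free monoid on \<open>'x\<close>, written additively because \<^typ>\<open>'m \<Rightarrow>\<^sub>0 'k\<close> is the monoid
  algebra of an additive monoid.\<close>

datatype 'x free_monoid = Word (letters: "'x list")

instantiation free_monoid :: (type) monoid_add
begin

definition zero_free_monoid :: "'a free_monoid" where "0 = Word []"
definition plus_free_monoid :: "'a free_monoid \<Rightarrow> 'a free_monoid \<Rightarrow> 'a free_monoid" where
  "x + y = Word (letters x @ letters y)"

instance
  by standard (auto simp: zero_free_monoid_def plus_free_monoid_def)

end

type_synonym ('x, 'k) free_algebra = "'x free_monoid \<Rightarrow>\<^sub>0 'k"

definition gen :: "'x \<Rightarrow> ('x, 'k::field) free_algebra" where
  "gen x = Poly_Mapping.single (Word [x]) 1"

interpretation fa: k_algebra "pm_scale :: 'k \<Rightarrow> ('x, 'k::field) free_algebra \<Rightarrow> ('x, 'k) free_algebra"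
proof unfold_locales
  have s: "pm_scale c p = Poly_Mapping.single 0 c * p" for c and p :: "('x, 'k) free_algebra"
    by (simp add: pm_scale_def mult_map_scale_conv_mult)
  fix c and x y :: "('x, 'k) free_algebra"
  show "pm_scale c x * y = pm_scale c (x * y)" by (simp add: s mult.assoc)
  have "x * Poly_Mapping.single 0 c = Poly_Mapping.single 0 c * x"
    by (induction x rule: pm_induct) (auto simp: mult_single distrib_left distrib_right mult.commute)
  then show "x * pm_scale c y = pm_scale c (x * y)" by (simp add: s flip: mult.assoc)
qed

definition free_lift :: "('k::field \<Rightarrow> 'a::ring_1 \<Rightarrow> 'a) \<Rightarrow> ('x \<Rightarrow> 'a) \<Rightarrow> ('x, 'k) free_algebra \<Rightarrow> 'a" where
  "free_lift s f = lin_ext s (\<lambda>w. prod_list (map f (letters w)))"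

context k_algebra
begin

lemma free_lift_add: "free_lift scale f (p + q) = free_lift scale f p + free_lift scale f q"
  and free_lift_scale: "free_lift scale f (pm_scale c p) = scale c (free_lift scale f p)"
  and free_lift_0: "free_lift scale f 0 = 0"
  by (simp_all add: free_lift_def lin_ext_add lin_ext_scale)

lemma free_lift_1: "free_lift scale f 1 = 1"
proof -
  have "free_lift scale f (Poly_Mapping.single 0 1) = 1"
    unfolding free_lift_def lin_ext_single by (simp add: zero_free_monoid_def)
  then show ?thesis by simp
qed

lemma free_lift_gen: "free_lift scale f (gen x) = f x"
  by (simp add: free_lift_def gen_def)

lemma free_lift_mult: "free_lift scale f (p * q) = free_lift scale f p * free_lift scale f q"
proof (induction p rule: pm_induct)
  case (2 w c)
  have "free_lift scale f (Poly_Mapping.single w c * Poly_Mapping.single w' d) =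
      free_lift scale f (Poly_Mapping.single w c) * free_lift scale f (Poly_Mapping.single w' d)" for w' d
    by (simp add: mult_single free_lift_def scale_mult_left scale_mult_right plus_free_monoid_def)
  then show ?case
    by (induction q rule: pm_induct) (simp_all add: free_lift_add free_lift_0 distrib_left)
qed (simp_all add: free_lift_add free_lift_0 distrib_right)

lemma free_lift_diff: "free_lift scale f (p - q) = free_lift scale f p - free_lift scale f q"
  using free_lift_add[of f "p - q" q] by (simp add: algebra_simps)

lemma free_lift_hom: "algebra_hom pm_scale scale (free_lift scale f)"
  unfolding algebra_hom_def
  using lin_ext_linear by (auto simp: free_lift_mult free_lift_1) (simp add: free_lift_def)

lemma free_lift_ideal:
  assumes "\<And>p. p \<in> S \<Longrightarrow> free_lift scale f p = 0" "p \<in> two_sided_ideal hull S"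
  shows "free_lift scale f p = 0"
proof -
  have "two_sided_ideal {p. free_lift scale f p = 0}"
    by (auto simp: two_sided_ideal_def free_lift_0 free_lift_add free_lift_mult)
  then have "two_sided_ideal hull S \<subseteq> {p. free_lift scale f p = 0}"
    using assms(1) by (intro hull_minimal) auto
  then show ?thesis using assms(2) by auto
qed

end

interpretation ground: k_algebra "(*) :: 'k \<Rightarrow> 'k \<Rightarrow> 'k::field"
  by unfold_locales (auto simp: algebra_simps)

lemma one_not_in_ideal:
  assumes "\<And>p. p \<in> S \<Longrightarrow> free_lift (*) (\<lambda>_. 0) p = 0"
  shows "(1 :: ('x, 'k::field) free_algebra) \<notin> two_sided_ideal hull S"
  using ground.free_lift_ideal[OF assms] by (force simp: ground.free_lift_1)

lemma free_algebra_induct: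
  assumes "P 1" "\<And>x. P (gen x)" "\<And>p q. P p \<Longrightarrow> P q \<Longrightarrow> P (p * q)"
    "\<And>p q. P p \<Longrightarrow> P q \<Longrightarrow> P (p + q)" "\<And>c p. P p \<Longrightarrow> P (pm_scale c p)"
  shows "P (p :: ('x, 'k::field) free_algebra)"
proof (induction p rule: pm_induct)
  case 1
  show ?case using assms(5)[OF assms(1), of 0] by simp
next
  case (2 w c)
  have "P (Poly_Mapping.single (Word xs) 1)" for xs
  proof (induction xs)
    case Nil
    show ?case using assms(1) by (simp flip: zero_free_monoid_def)
  next
    case (Cons x xs)
    have "(Poly_Mapping.single (Word (x # xs)) 1 :: ('x, 'k) free_algebra)
        = gen x * Poly_Mapping.single (Word xs) 1"
      by (simp add: gen_def mult_single plus_free_monoid_def)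
    then show ?case using assms(2,3) Cons by metis
  qed
  from assms(5)[OF this, of c "letters w"] show ?case by simp
qed (rule assms(4))


section \<open>Universal enveloping algebras\<close>

text \<open>The enveloping algebra of a Lie algebra \<open>L\<close> is the tensor algebra of \<open>L\<close> modulo the relations
  \<open>x \<otimes> y - y \<otimes> x = [x, y]\<close>. The tensor algebra is in turn presented as the free algebra on the
  underlying set of \<open>L\<close> modulo the linearity relations of \<open>L\<close>, which are the first two families.\<close>

definition env_relators ::
  "('k::field \<Rightarrow> 'l::ab_group_add \<Rightarrow> 'l) \<Rightarrow> ('l \<Rightarrow> 'l \<Rightarrow> 'l) \<Rightarrow> ('l, 'k) free_algebra set" where
  "env_relators s br =
     {gen (x + y) - gen x - gen y | x y. True} \<union>
     {gen (s c x) - pm_scale c (gen x) | c x. True} \<union>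
     {gen x * gen y - gen y * gen x - gen (br x y) | x y. True}"


section \<open>The positive Witt algebra\<close>

typedef posnat = "{n::nat. n \<ge> 1}" morphisms nat_of posnat
  by auto

instantiation posnat :: plus
begin
definition plus_posnat :: "posnat \<Rightarrow> posnat \<Rightarrow> posnat" where
  "m + n = posnat (nat_of m + nat_of n)"
instance ..
end

lemma nat_of_ge_1: "nat_of m \<ge> 1"
  using nat_of[of m] by simp

lemma nat_of_plus [simp]: "nat_of (m + n) = nat_of m + nat_of n"
  unfolding plus_posnat_def using nat_of_ge_1[of m] by (simp add: posnat_inverse)

type_synonym 'k witt = "posnat \<Rightarrow>\<^sub>0 'k"

definition witt_basis :: "posnat \<Rightarrow> 'k::field_char_0 witt" where
  "witt_basis n = Poly_Mapping.single n 1"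

text \<open>The bilinear extension of \<open>[e\<^sub>n, e\<^sub>m] = (m - n) e\<^bsub>n+m\<^esub>\<close>.\<close>

definition witt_bracket :: "'k::field_char_0 witt \<Rightarrow> 'k witt \<Rightarrow> 'k witt" where
  "witt_bracket x y =
     lin_ext pm_scale (\<lambda>n. lin_ext pm_scale
       (\<lambda>m. pm_scale (of_nat (nat_of m) - of_nat (nat_of n)) (witt_basis (n + m))) y) x"

lemma witt_bracket_basis:
  "witt_bracket (witt_basis n) (witt_basis m) =
     pm_scale (of_nat (nat_of m) - of_nat (nat_of n)) (witt_basis (n + m))"
  by (simp add: witt_bracket_def witt_basis_def)

lemma witt_bracket_single:
  "witt_bracket (Poly_Mapping.single n c) (Poly_Mapping.single m d) =
     Poly_Mapping.single (n + m) (c * d * (of_nat (nat_of m) - of_nat (nat_of n)))"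
  unfolding witt_bracket_def witt_basis_def pm.lin_ext_single pm_scale_single mult_1_right mult.assoc ..

lemma witt_bracket_add_left: "witt_bracket (x + y) z = witt_bracket x z + witt_bracket y z"
  and witt_bracket_add_right: "witt_bracket z (x + y) = witt_bracket z x + witt_bracket z y"
  and witt_bracket_scale_left: "witt_bracket (pm_scale c x) y = pm_scale c (witt_bracket x y)"
  and witt_bracket_scale_right: "witt_bracket x (pm_scale c y) = pm_scale c (witt_bracket x y)"
  and witt_bracket_0_left: "witt_bracket 0 y = 0"
  and witt_bracket_0_right: "witt_bracket x 0 = 0"
  by (simp_all add: witt_bracket_def pm.lin_ext_add pm.lin_ext_scale pm.lin_ext_fun_add
      pm.lin_ext_fun_scale) (simp add: lin_ext_def)

lemmas witt_bracket_bilinear = witt_bracket_add_left witt_bracket_add_right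
  witt_bracket_0_left witt_bracket_0_right

lemma posnat_eqI: "nat_of m = nat_of n \<Longrightarrow> m = n"
  by (simp add: nat_of_inject)

lemma posnat_ac: "(m :: posnat) + n = n + m" "(m + n) + k = m + (n + k)" "m + (n + k) = n + (m + k)"
  by (rule posnat_eqI, simp)+

lemma witt_bracket_skew: "witt_bracket x y = - witt_bracket y x"
proof (induction x rule: pm_induct)
  case (2 n c)
  show ?case
  proof (induction y rule: pm_induct)
    case (2 m d)
    have id: "d * c * (N - M) = - (c * d * (M - N))" for M N :: 'a by algebra
    show ?case
      unfolding witt_bracket_single posnat_ac(1)[of m n] id single_uminus by (rule minus_minus[symmetric])
  qed (simp_all add: witt_bracket_bilinear)
qed (simp_all add: witt_bracket_bilinear)

interpretation witt: lie_algebra pm_scale witt_bracket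
proof (unfold_locales, goal_cases)
  case (5 x)
  have "witt_bracket x x = - witt_bracket x x" by (rule witt_bracket_skew)
  then have "Poly_Mapping.lookup (witt_bracket x x) k = - Poly_Mapping.lookup (witt_bracket x x) k" for k
    by (metis lookup_uminus)
  then show ?case by (intro poly_mapping_eqI) simp
next
  case (6 x y z)
  define J where "J x y z = witt_bracket x (witt_bracket y z) + witt_bracket y (witt_bracket z x)
    + witt_bracket z (witt_bracket x y)" for x y z :: "'a witt"
  have J_add: "J (p + q) y z = J p y z + J q y z" "J x (p + q) z = J x p z + J x q z"
    "J x y (p + q) = J x y p + J x y q" for x y z p q
    unfolding J_def witt_bracket_add_left witt_bracket_add_right by (simp_all only: add_ac)
  have J_0: "J 0 y z = 0" "J x 0 z = 0" "J x y 0 = 0" for x y z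
    by (simp_all add: J_def witt_bracket_bilinear)
  have J_single: "J (Poly_Mapping.single n c) (Poly_Mapping.single m d) (Poly_Mapping.single k f) = 0"
    for n m k c d f
  proof -
    have p: "m + (k + n) = n + (m + k)" "k + (n + m) = n + (m + k)"
      by (rule posnat_eqI, simp)+
    have id: "c * (d * f * (K - M)) * ((M + K) - N) + d * (f * c * (N - K)) * ((K + N) - M)
        + f * (c * d * (M - N)) * ((N + M) - K) = 0" for K M N :: 'a
      by algebra
    show ?thesis
      unfolding J_def witt_bracket_single p single_add[symmetric] nat_of_plus of_nat_add id
      by (rule single_zero)
  qed
  have "J x y z = 0"
  proof (induction x rule: pm_induct)
    case (2 n c)
    show ?case
    proof (induction y rule: pm_induct)
      case (2 m d)
      show ?case by (induction z rule: pm_induct) (simp_all add: J_0 J_add J_single)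
    qed (simp_all add: J_0 J_add)
  qed (simp_all add: J_0 J_add)
  then show ?case by (simp add: J_def)
qed (simp_all add: witt_bracket_add_left witt_bracket_add_right witt_bracket_scale_left
    witt_bracket_scale_right)


section \<open>The algebra \<open>U(W\<^sub>+)\<close>\<close>

definition U_ideal :: "('k::field_char_0 witt, 'k) free_algebra set" where
  "U_ideal = two_sided_ideal hull (env_relators pm_scale witt_bracket)"

lemma two_sided_U_ideal: "two_sided_ideal U_ideal"
  unfolding U_ideal_def by (rule two_sided_ideal_hull)

lemma one_notin_U_ideal: "1 \<notin> U_ideal"
  unfolding U_ideal_def
  by (rule one_not_in_ideal) (auto simp: env_relators_def ground.free_lift_diff
      ground.free_lift_scale ground.free_lift_gen ground.free_lift_mult)

quotient_type (overloaded) 'k U_witt = "('k::field_char_0 witt, 'k) free_algebra" /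
  "\<lambda>x y. x - y \<in> U_ideal"
  by (rule equivp_ideal[OF two_sided_U_ideal])

lemma U_witt_abs_cases: obtains p where "z = abs_U_witt p"
  by (metis Quotient_abs_rep[OF Quotient_U_witt])

instantiation U_witt :: (field_char_0) ring_1
begin

lift_definition zero_U_witt :: "'a U_witt" is 0 .
lift_definition one_U_witt :: "'a U_witt" is 1 .
lift_definition plus_U_witt :: "'a U_witt \<Rightarrow> 'a U_witt \<Rightarrow> 'a U_witt" is "(+)"
  by (rule ideal_cong[OF two_sided_U_ideal])
lift_definition minus_U_witt :: "'a U_witt \<Rightarrow> 'a U_witt \<Rightarrow> 'a U_witt" is "(-)"
  by (rule ideal_cong[OF two_sided_U_ideal])
lift_definition times_U_witt :: "'a U_witt \<Rightarrow> 'a U_witt \<Rightarrow> 'a U_witt" is "(*)"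
  by (rule ideal_cong[OF two_sided_U_ideal])
lift_definition uminus_U_witt :: "'a U_witt \<Rightarrow> 'a U_witt" is uminus
  by (rule ideal_cong[OF two_sided_U_ideal])

instance
proof
  fix a b c :: "'a U_witt"
  note ops = zero_U_witt.abs_eq one_U_witt.abs_eq plus_U_witt.abs_eq minus_U_witt.abs_eq times_U_witt.abs_eq uminus_U_witt.abs_eq
  show "a + b + c = a + (b + c)" "a * b * c = a * (b * c)"
    "(a + b) * c = a * c + b * c" "a * (b + c) = a * b + a * c"
    by (cases a rule: U_witt_abs_cases, cases b rule: U_witt_abs_cases, cases c rule: U_witt_abs_cases,
        simp add: ops add.assoc mult.assoc distrib_left distrib_right)+
  show "a + b = b + a" "a - b = a + - b" by (cases a rule: U_witt_abs_cases, cases b rule: U_witt_abs_cases, simp add: ops add.commute)+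
  show "0 + a = a" "- a + a = 0" "1 * a = a" "a * 1 = a" by (cases a rule: U_witt_abs_cases, simp add: ops)+
  show "(0 :: 'a U_witt) \<noteq> 1"
    using two_sided_ideal_uminus[OF two_sided_U_ideal, of "-1"] one_notin_U_ideal
    by (auto simp: ops U_witt.abs_eq_iff)
qed

end

lift_definition U_scale :: "'k::field_char_0 \<Rightarrow> 'k U_witt \<Rightarrow> 'k U_witt" is pm_scale
proof -
  fix c :: 'k and x y :: "('k witt, 'k) free_algebra"
  assume "x - y \<in> U_ideal"
  from two_sided_ideal_mult_left[OF two_sided_U_ideal this, of "pm_scale c 1"]
  show "pm_scale c x - pm_scale c y \<in> U_ideal"
    by (simp add: fa.scale_mult_left pm.scale_right_diff_distrib)
qed

interpretation U: k_algebra U_scale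
proof
  fix c d :: 'a and x y :: "'a U_witt"
  note ops = plus_U_witt.abs_eq times_U_witt.abs_eq U_scale.abs_eq
  show "U_scale c (x + y) = U_scale c x + U_scale c y"
    "U_scale c x * y = U_scale c (x * y)" "x * U_scale c y = U_scale c (x * y)"
    by (cases x rule: U_witt_abs_cases, cases y rule: U_witt_abs_cases,
        simp add: ops pm.scale_right_distrib fa.scale_mult_left fa.scale_mult_right)+
  show "U_scale (c + d) x = U_scale c x + U_scale d x" "U_scale c (U_scale d x) = U_scale (c * d) x"
    "U_scale 1 x = x"
    by (cases x rule: U_witt_abs_cases, simp add: ops pm.scale_left_distrib)+
qed

definition U_incl :: "'k::field_char_0 witt \<Rightarrow> 'k U_witt" where
  "U_incl x = abs_U_witt (gen x)"

lemma U_witt_eqI: "p - q \<in> env_relators pm_scale witt_bracket \<Longrightarrow> abs_U_witt p = abs_U_witt q"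
  by (simp add: U_witt.abs_eq_iff U_ideal_def hull_inc)

lemma U_incl_add: "U_incl (x + y) = U_incl x + U_incl y"
  unfolding U_incl_def plus_U_witt.abs_eq
  by (rule U_witt_eqI) (auto simp: env_relators_def diff_diff_eq[symmetric])

lemma U_incl_scale: "U_incl (pm_scale c x) = U_scale c (U_incl x)"
  unfolding U_incl_def U_scale.abs_eq
  by (rule U_witt_eqI) (auto simp: env_relators_def)

lemma U_incl_bracket: "U_incl x * U_incl y - U_incl y * U_incl x = U_incl (witt_bracket x y)"
  unfolding U_incl_def times_U_witt.abs_eq minus_U_witt.abs_eq
  by (rule U_witt_eqI) (auto simp: env_relators_def)

lemma U_induct:
  assumes "P 1" "\<And>x. P (U_incl x)" "\<And>p q. P p \<Longrightarrow> P q \<Longrightarrow> P (p * q)"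
    "\<And>p q. P p \<Longrightarrow> P q \<Longrightarrow> P (p + q)" "\<And>c p. P p \<Longrightarrow> P (U_scale c p)"
  shows "P z"
proof -
  have "P (abs_U_witt p)" for p
    by (induction p rule: free_algebra_induct)
      (metis assms one_U_witt.abs_eq U_incl_def times_U_witt.abs_eq plus_U_witt.abs_eq
        U_scale.abs_eq)+
  then show ?thesis by (cases z rule: U_witt_abs_cases) simp
qed

text \<open>The universal property of the enveloping algebra.\<close>

lemma U_universal:
  fixes s :: "'k::field_char_0 \<Rightarrow> 'a::ring_1 \<Rightarrow> 'a"
  assumes "k_algebra s" and f: "Vector_Spaces.linear pm_scale s f"
    and br: "\<And>x y. f (witt_bracket x y) = f x * f y - f y * f x"
  shows "\<exists>!h. algebra_hom U_scale s h \<and> (\<forall>x. h (U_incl x) = f x)"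
proof -
  interpret A: k_algebra s by fact
  interpret f: Vector_Spaces.linear pm_scale s f by fact
  have "free_lift s f p = free_lift s f q" if "p - q \<in> U_ideal" for p q
  proof -
    have "free_lift s f (p - q) = 0"
      using that unfolding U_ideal_def
      by (rule A.free_lift_ideal[rotated]) (auto simp: env_relators_def A.free_lift_diff A.free_lift_scale
          A.free_lift_gen A.free_lift_mult br f.add f.scale)
    then show ?thesis by (simp add: A.free_lift_diff)
  qed
  moreover have "rep_U_witt (abs_U_witt p) - p \<in> U_ideal" for p :: "('k witt, 'k) free_algebra"
    using Quotient_abs_rep[OF Quotient_U_witt, of "abs_U_witt p"] by (simp add: U_witt.abs_eq_iff)
  ultimately have wd: "free_lift s f (rep_U_witt (abs_U_witt p)) = free_lift s f p" for p
    by blast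
  define h where "h z = free_lift s f (rep_U_witt z)" for z
  have h: "h (abs_U_witt p) = free_lift s f p" for p by (simp add: h_def wd)
  have "h (x + y) = h x + h y" "h (x * y) = h x * h y" "h (U_scale c x) = s c (h x)" for x y c
    by (cases x rule: U_witt_abs_cases, cases y rule: U_witt_abs_cases, simp add: h plus_U_witt.abs_eq times_U_witt.abs_eq U_scale.abs_eq
        A.free_lift_add A.free_lift_mult A.free_lift_scale)+
  moreover have "h 1 = 1" "h (U_incl x) = f x" for x
    by (simp_all add: one_U_witt.abs_eq U_incl_def h A.free_lift_1 A.free_lift_gen)
  ultimately have ex: "algebra_hom U_scale s h \<and> (\<forall>x. h (U_incl x) = f x)"
    unfolding algebra_hom_def by (auto intro!: Vector_Spaces.linear.intro module_hom.intro
        module_hom_axioms.intro simp: U.module_axioms A.module_axioms U.vector_space_axioms A.vector_space_axioms)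
  show ?thesis
  proof (rule ex1I[of _ h], rule ex, rule ext)
    fix g z
    assume g: "algebra_hom U_scale s g \<and> (\<forall>x. g (U_incl x) = f x)"
    interpret g: Vector_Spaces.linear U_scale s g using g by (simp add: algebra_hom_def)
    interpret h: Vector_Spaces.linear U_scale s h using ex by (simp add: algebra_hom_def)
    show "g z = h z"
      using g ex unfolding algebra_hom_def
      by (induction z rule: U_induct) (auto simp: g.add h.add g.scale h.scale)
  qed
qed

text \<open>\<open>U_e n\<close> is the image of the basis vector \<open>e\<^sub>n\<close> in \<open>U(W\<^sub>+)\<close>; only \<open>n \<ge> 1\<close> is meaningful.\<close>

definition U_e :: "nat \<Rightarrow> 'k::field_char_0 U_witt" where
  "U_e n = U_incl (witt_basis (posnat n))"


section \<open>The Jordan plane\<close>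

datatype jordan_gen = Gen_u | Gen_v

definition jordan_ideal :: "(jordan_gen, 'k::field_char_0) free_algebra set" where
  "jordan_ideal = two_sided_ideal hull {gen Gen_u * gen Gen_v - gen Gen_v * gen Gen_u - gen Gen_v ^ 2}"

lemma two_sided_jordan_ideal: "two_sided_ideal jordan_ideal"
  unfolding jordan_ideal_def by (rule two_sided_ideal_hull)

lemma one_notin_jordan_ideal: "1 \<notin> jordan_ideal"
  unfolding jordan_ideal_def
  by (rule one_not_in_ideal) (auto simp: ground.free_lift_diff
      ground.free_lift_gen ground.free_lift_mult power2_eq_square)

quotient_type (overloaded) 'k jordan = "(jordan_gen, 'k::field_char_0) free_algebra" /
  "\<lambda>x y. x - y \<in> jordan_ideal"
  by (rule equivp_ideal[OF two_sided_jordan_ideal])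

lemma jordan_abs_cases: obtains p where "z = abs_jordan p"
  by (metis Quotient_abs_rep[OF Quotient_jordan])

instantiation jordan :: (field_char_0) ring_1
begin

lift_definition zero_jordan :: "'a jordan" is 0 .
lift_definition one_jordan :: "'a jordan" is 1 .
lift_definition plus_jordan :: "'a jordan \<Rightarrow> 'a jordan \<Rightarrow> 'a jordan" is "(+)"
  by (rule ideal_cong[OF two_sided_jordan_ideal])
lift_definition minus_jordan :: "'a jordan \<Rightarrow> 'a jordan \<Rightarrow> 'a jordan" is "(-)"
  by (rule ideal_cong[OF two_sided_jordan_ideal])
lift_definition times_jordan :: "'a jordan \<Rightarrow> 'a jordan \<Rightarrow> 'a jordan" is "(*)"
  by (rule ideal_cong[OF two_sided_jordan_ideal])
lift_definition uminus_jordan :: "'a jordan \<Rightarrow> 'a jordan" is uminus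
  by (rule ideal_cong[OF two_sided_jordan_ideal])

instance
proof
  fix a b c :: "'a jordan"
  note ops = zero_jordan.abs_eq one_jordan.abs_eq plus_jordan.abs_eq minus_jordan.abs_eq times_jordan.abs_eq uminus_jordan.abs_eq
  show "a + b + c = a + (b + c)" "a * b * c = a * (b * c)"
    "(a + b) * c = a * c + b * c" "a * (b + c) = a * b + a * c"
    by (cases a rule: jordan_abs_cases, cases b rule: jordan_abs_cases, cases c rule: jordan_abs_cases,
        simp add: ops add.assoc mult.assoc distrib_left distrib_right)+
  show "a + b = b + a" "a - b = a + - b" by (cases a rule: jordan_abs_cases, cases b rule: jordan_abs_cases, simp add: ops add.commute)+
  show "0 + a = a" "- a + a = 0" "1 * a = a" "a * 1 = a" by (cases a rule: jordan_abs_cases, simp add: ops)+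
  show "(0 :: 'a jordan) \<noteq> 1"
    using two_sided_ideal_uminus[OF two_sided_jordan_ideal, of "-1"] one_notin_jordan_ideal
    by (auto simp: ops jordan.abs_eq_iff)
qed

end

lift_definition R_scale :: "'k::field_char_0 \<Rightarrow> 'k jordan \<Rightarrow> 'k jordan" is pm_scale
proof -
  fix c :: 'k and x y :: "(jordan_gen, 'k) free_algebra"
  assume "x - y \<in> jordan_ideal"
  from two_sided_ideal_mult_left[OF two_sided_jordan_ideal this, of "pm_scale c 1"]
  show "pm_scale c x - pm_scale c y \<in> jordan_ideal"
    by (simp add: fa.scale_mult_left pm.scale_right_diff_distrib)
qed

interpretation R: k_algebra R_scale
proof
  fix c d :: 'a and x y :: "'a jordan"
  note ops = plus_jordan.abs_eq times_jordan.abs_eq R_scale.abs_eq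
  show "R_scale c (x + y) = R_scale c x + R_scale c y"
    "R_scale c x * y = R_scale c (x * y)" "x * R_scale c y = R_scale c (x * y)"
    by (cases x rule: jordan_abs_cases, cases y rule: jordan_abs_cases,
        simp add: ops pm.scale_right_distrib fa.scale_mult_left fa.scale_mult_right)+
  show "R_scale (c + d) x = R_scale c x + R_scale d x" "R_scale c (R_scale d x) = R_scale (c * d) x"
    "R_scale 1 x = x"
    by (cases x rule: jordan_abs_cases, simp add: ops pm.scale_left_distrib)+
qed

definition R_u :: "'k::field_char_0 jordan" where "R_u = abs_jordan (gen Gen_u)"
definition R_v :: "'k::field_char_0 jordan" where "R_v = abs_jordan (gen Gen_v)"

lemma R_relation: "R_u * R_v - R_v * R_u - R_v ^ 2 = (0 :: 'k::field_char_0 jordan)"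
proof -
  have "gen Gen_u * gen Gen_v - gen Gen_v * gen Gen_u - gen Gen_v ^ 2 \<in>
      (jordan_ideal :: (jordan_gen, 'k) free_algebra set)"
    unfolding jordan_ideal_def by (rule hull_inc) simp
  then show ?thesis
    by (simp add: R_u_def R_v_def power2_eq_square times_jordan.abs_eq minus_jordan.abs_eq
        zero_jordan.abs_eq jordan.abs_eq_iff)
qed


section \<open>The homomorphisms \<open>\<lambda>\<^sub>a\<close>\<close>

definition lambda_e :: "'k::field_char_0 \<Rightarrow> nat \<Rightarrow> 'k jordan" where
  "lambda_e a n = (R_u - R_scale (of_nat (n - 1) * a) R_v) * R_v ^ (n - 1)"

definition is_lambda :: "'k::field_char_0 \<Rightarrow> ('k U_witt \<Rightarrow> 'k jordan) \<Rightarrow> bool" where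
  "is_lambda a h \<longleftrightarrow> algebra_hom U_scale R_scale h \<and> (\<forall>n\<ge>1. h (U_e n) = lambda_e a n)"

text \<open>Existence and uniqueness of \<open>\<lambda>\<^sub>a\<close> are shown in \<open>ex1_lambda\<close> below.\<close>

definition lambda_hom :: "'k::field_char_0 \<Rightarrow> 'k U_witt \<Rightarrow> 'k jordan" where
  "lambda_hom a = (THE h. is_lambda a h)"

lemma R_uv: "R_u * R_v = R_v * R_u + R_v * (R_v :: 'k::field_char_0 jordan)"
  using R_relation[where 'k = 'k] by (simp add: power2_eq_square algebra_simps)

lemma R_vu: "R_v ^ n * R_u = R_u * R_v ^ n - R_scale (of_nat n) (R_v ^ Suc n :: 'k::field_char_0 jordan)"
proof (induction n)
  case (Suc n)
  have "R_v ^ Suc n * (R_u :: 'k jordan) = R_v * (R_v ^ n * R_u)" by (simp add: mult.assoc)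
  also have "\<dots> = (R_v * R_u) * R_v ^ n - R_scale (of_nat n) (R_v ^ Suc (Suc n))"
    unfolding Suc by (simp add: right_diff_distrib R.scale_mult_right mult.assoc)
  also have "R_v * (R_u :: 'k jordan) = R_u * R_v - R_v * R_v" by (simp add: R_uv)
  finally show ?case
    by (simp add: left_diff_distrib R.scale_left_distrib algebra_simps)
qed simp

lemma lambda_e_mult:
  fixes a :: "'k::field_char_0"
  shows "lambda_e a (Suc p) * lambda_e a (Suc q) =
    R_u * R_u * R_v ^ (p + q) - R_scale (of_nat p * a + of_nat p + of_nat q * a) (R_u * R_v ^ Suc (p + q))
      + R_scale (of_nat p * a * (1 + of_nat p + of_nat q * a)) (R_v ^ Suc (Suc (p + q)))"
proof -
  define u v :: "'k jordan" where "u = R_u" and "v = R_v"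
  define \<alpha> \<beta> where "\<alpha> = of_nat p * a" and "\<beta> = of_nat q * a"
  have vn: "v ^ p * v ^ q = v ^ (p + q)" by (simp add: power_add)
  have v_u: "v ^ n * u = u * v ^ n - R_scale (of_nat n) (v ^ Suc n)" for n
    unfolding u_def v_def by (rule R_vu)
  have v_v: "v ^ n * v = v ^ Suc n" for n by (simp add: power_commutes)
  have vuv: "v * u = u * v - v * v" unfolding u_def v_def by (simp add: R_uv)
  have "(u - R_scale \<alpha> v) * v ^ p * ((u - R_scale \<beta> v) * v ^ q)
      = (u - R_scale \<alpha> v) * (v ^ p * (u - R_scale \<beta> v)) * v ^ q"
    by (simp add: mult.assoc)
  also have "v ^ p * (u - R_scale \<beta> v) = u * v ^ p - R_scale (of_nat p + \<beta>) (v * v ^ p)"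
    by (simp add: right_diff_distrib v_u R.scale_mult_right v_v R.scale_left_distrib)
  also have "(u - R_scale \<alpha> v) * (u * v ^ p - R_scale (of_nat p + \<beta>) (v * v ^ p)) * v ^ q
      = (u - R_scale \<alpha> v) * (u - R_scale (of_nat p + \<beta>) v) * v ^ (p + q)"
    by (simp add: left_diff_distrib right_diff_distrib R.scale_mult_left R.scale_mult_right mult.assoc vn)
  also have "(u - R_scale \<alpha> v) * (u - R_scale (of_nat p + \<beta>) v)
      = u * u - R_scale (of_nat p + \<beta>) (u * v) - R_scale \<alpha> (v * u) + R_scale (\<alpha> * (of_nat p + \<beta>)) (v * v)"
    by (simp add: left_diff_distrib right_diff_distrib R.scale_mult_left R.scale_mult_right
        R.scale_right_diff_distrib mult.commute[of \<alpha>])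
  also have "\<dots> = u * u - R_scale (\<alpha> + of_nat p + \<beta>) (u * v) + R_scale (\<alpha> * (1 + of_nat p + \<beta>)) (v * v)"
    unfolding vuv by (simp add: R.scale_right_diff_distrib R.scale_left_distrib distrib_left algebra_simps)
  also have "\<dots> * v ^ (p + q) = u * u * v ^ (p + q)
      - R_scale (\<alpha> + of_nat p + \<beta>) (u * v ^ Suc (p + q))
      + R_scale (\<alpha> * (1 + of_nat p + \<beta>)) (v ^ Suc (Suc (p + q)))"
    by (simp only: left_diff_distrib distrib_right R.scale_mult_left mult.assoc power_Suc)
  finally show ?thesis
    unfolding lambda_e_def diff_Suc_1 \<alpha>_def \<beta>_def u_def v_def .
qed

lemma lambda_e_bracket:
  fixes a :: "'k::field_char_0"
  assumes "n \<ge> 1" "m \<ge> 1"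
  shows "lambda_e a n * lambda_e a m - lambda_e a m * lambda_e a n =
    R_scale (of_nat m - of_nat n) (lambda_e a (n + m))"
proof -
  obtain p where n: "n = Suc p" using assms(1) by (cases n) auto
  obtain q where m: "m = Suc q" using assms(2) by (cases m) auto
  define X Y where "X = (R_u * R_v ^ Suc (p + q) :: 'k jordan)" and "Y = (R_v ^ Suc (Suc (p + q)) :: 'k jordan)"
  have "lambda_e a n * lambda_e a m - lambda_e a m * lambda_e a n
     = R_scale (of_nat q - of_nat p) X
       - R_scale ((of_nat q - of_nat p) * (of_nat (Suc (p + q)) * a)) Y"
  proof -
    have c: "of_nat q - of_nat p
        = (of_nat q * a + of_nat q + of_nat p * a) - (of_nat p * a + of_nat p + of_nat q * a)"
      by simp
    have "(Q - P) * ((1 + (P + Q)) * a) = Q * a * (1 + Q + P * a) - P * a * (1 + P + Q * a)" for P Q :: 'k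
      by algebra
    then have d: "(of_nat q - of_nat p) * (of_nat (Suc (p + q)) * a) =
        of_nat q * a * (1 + of_nat q + of_nat p * a) - of_nat p * a * (1 + of_nat p + of_nat q * a)"
      by (simp only: of_nat_Suc of_nat_add)
    have g: "(A - R_scale r X + R_scale t Y) - (A - R_scale r' X + R_scale t' Y)
        = R_scale (r' - r) X - R_scale (t' - t) Y" for A r t r' t'
      by (simp add: R.scale_left_diff_distrib)
    show ?thesis
      unfolding n m lambda_e_mult add.commute[of q p] X_def[symmetric] Y_def[symmetric] g c[symmetric] d ..
  qed
  also have "\<dots> = R_scale (of_nat m - of_nat n) (lambda_e a (n + m))"
    unfolding n m X_def Y_def lambda_e_def
    by (simp add: left_diff_distrib R.scale_mult_left R.scale_right_diff_distrib)
  finally show ?thesis .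
qed

lemma ex1_lambda: "\<exists>!h. is_lambda (a :: 'k::field_char_0) h"
proof -
  define f where "f = lin_ext R_scale (\<lambda>n. lambda_e a (nat_of n))"
  interpret f: Vector_Spaces.linear pm_scale R_scale f
    unfolding f_def by (rule R.lin_ext_linear)
  have br: "f (witt_bracket x y) = f x * f y - f y * f x" for x y
  proof (induction x rule: pm_induct)
    case (2 n c)
    show ?case
    proof (induction y rule: pm_induct)
      case (2 m d)
      have "f (witt_bracket (Poly_Mapping.single n c) (Poly_Mapping.single m d))
        = R_scale (c * d) (R_scale (of_nat (nat_of m) - of_nat (nat_of n)) (lambda_e a (nat_of n + nat_of m)))"
        by (simp add: witt_bracket_single f_def)
      also have "\<dots> = R_scale (c * d)
          (lambda_e a (nat_of n) * lambda_e a (nat_of m) - lambda_e a (nat_of m) * lambda_e a (nat_of n))"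
        by (simp only: lambda_e_bracket[OF nat_of_ge_1 nat_of_ge_1])
      finally show ?case
        by (simp add: f_def R.scale_mult_left R.scale_mult_right R.scale_right_diff_distrib mult.commute)
    qed (simp_all add: witt_bracket_bilinear f.add f.zero algebra_simps)
  qed (simp_all add: witt_bracket_bilinear f.add f.zero algebra_simps)
  have "is_lambda a h \<longleftrightarrow> algebra_hom U_scale R_scale h \<and> (\<forall>x. h (U_incl x) = f x)" for h
  proof (cases "algebra_hom U_scale R_scale h")
    case True
    interpret h: Vector_Spaces.linear U_scale R_scale h using True by (simp add: algebra_hom_def)
    have fe: "f (witt_basis (posnat n)) = lambda_e a n" if "n \<ge> 1" for n
      using that by (simp add: f_def witt_basis_def posnat_inverse)
    have "h (U_incl x) = f x" if *: "\<And>n. n \<ge> 1 \<Longrightarrow> h (U_e n) = lambda_e a n" for x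
    proof (induction x rule: pm_induct)
      case 1
      show ?case using U_incl_scale[of "0 :: 'k" 0] by (simp add: f.zero h.zero)
    next
      case (2 n c)
      have "Poly_Mapping.single n c = pm_scale c (witt_basis n)" by (simp add: witt_basis_def)
      moreover have "h (U_incl (witt_basis n)) = f (witt_basis n)"
        using *[of "nat_of n"] fe[of "nat_of n"] nat_of_ge_1[of n] by (simp add: U_e_def nat_of_inverse)
      ultimately show ?case by (simp add: U_incl_scale h.scale f.scale)
    qed (simp add: U_incl_add h.add f.add)
    then show ?thesis using True fe by (auto simp: is_lambda_def U_e_def)
  qed (simp add: is_lambda_def)
  then show ?thesis
    using U_universal[OF R.k_algebra_axioms f.linear_axioms br] by simp
qed

lemma is_lambda_lambda_hom: "is_lambda a (lambda_hom a)"
  unfolding lambda_hom_def by (rule theI'[OF ex1_lambda])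

end

theory Submission
  imports Defs
begin

text \<open>
  Write \<open>E\<^sub>p = e\<^bsub>p+1\<^esub>\<close> and \<open>D\<^bsub>p,q\<^esub> = E\<^sub>p E\<^sub>q - E\<^sub>0 E\<^bsub>p+q\<^esub> + p E\<^bsub>p+q+1\<^esub>\<close>, so that the generator of the ideal
  \<open>(r)\<close> is \<open>- D\<^bsub>1,1\<^esub>\<close>. Commutators with \<open>E\<^sub>0\<close> and \<open>E\<^sub>1\<close> produce all \<open>D\<^bsub>p,q\<^esub>\<close> from \<open>D\<^bsub>1,1\<^esub>\<close>, so modulo
  \<open>(r)\<close> the algebra is spanned by \<open>1\<close> and the \<open>E\<^sub>0\<^sup>k E\<^sub>n\<close>. Their images \<open>1\<close> and \<open>u\<^bsup>k+1\<^esup> v\<^sup>n\<close> under \<open>\<lambda>\<^sub>0\<close> are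
  linearly independent, whence \<open>ker \<lambda>\<^sub>0 = (r)\<close>. The identity \<open>u \<lambda>\<^sub>1(x) = \<lambda>\<^sub>0(x) u\<close> transfers this to \<open>\<lambda>\<^sub>1\<close>.

  Let \<open>\<delta>\<^sub>a\<close> be the derivative of \<open>\<lambda>\<^sub>a\<close> in the parameter. On the kernel of \<open>\<lambda>\<^sub>a\<close> (with \<open>a = 0, 1\<close>) it satisfies
  \<open>\<delta>\<^sub>a(x y) = \<lambda>\<^sub>a(x) \<delta>\<^sub>a(y)\<close> and \<open>\<delta>\<^sub>a(y x) = \<delta>\<^sub>a(y) \<lambda>\<^sub>a(x)\<close>, and \<open>\<delta>\<^sub>a(D\<^bsub>1,q\<^esub>) = (2 a - 1) q v\<^bsup>q+3\<^esup>\<close>. The image of \<open>\<lambda>\<^sub>0\<close> is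
  contained in \<open>k + u R\<close>. So if \<open>(r)\<close> were finitely generated as a left ideal, then \<open>\<delta>\<^sub>0(r)\<close> would be finite
  dimensional modulo \<open>u R\<close>, although it contains all \<open>v\<^sup>N\<close> with \<open>N \<ge> 4\<close>. On the right one argues in
  the same way with \<open>\<lambda>\<^sub>1\<close> and \<open>R u\<close>.
\<close>

section \<open>Normal forms in the Jordan plane\<close>

text \<open>The polynomial \<open>P\<close> stands for the element \<open>\<Sum> P\<^bsub>ij\<^esub> u\<^sup>i v\<^sup>j\<close>; \<open>nf_step g (i, j)\<close> is \<open>u\<^sup>i v\<^sup>j g\<close>,
  where \<open>v\<^sup>j u = u v\<^sup>j - j v\<^bsup>j+1\<^esup>\<close>.\<close>

fun nf_step :: "jordan_gen \<Rightarrow> nat \<times> nat \<Rightarrow> (nat \<times> nat) \<Rightarrow>\<^sub>0 'k::field_char_0" where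
  "nf_step Gen_u (i, j) = Poly_Mapping.single (Suc i, j) 1 - Poly_Mapping.single (i, Suc j) (of_nat j)"
| "nf_step Gen_v (i, j) = Poly_Mapping.single (i, Suc j) 1"

definition nf_mult :: "jordan_gen \<Rightarrow> ((nat \<times> nat) \<Rightarrow>\<^sub>0 'k) \<Rightarrow> (nat \<times> nat) \<Rightarrow>\<^sub>0 'k::field_char_0" where
  "nf_mult g = lin_ext pm_scale (nf_step g)"

text \<open>Folding from the left gives a right action: the letters multiply \<open>P\<close> on the
  right in reading order.\<close>

definition word_act :: "((nat \<times> nat) \<Rightarrow>\<^sub>0 'k) \<Rightarrow> jordan_gen free_monoid \<Rightarrow> (nat \<times> nat) \<Rightarrow>\<^sub>0 'k::field_char_0" where
  "word_act P w = foldl (\<lambda>Q g. nf_mult g Q) P (letters w)"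

definition free_act ::
  "((nat \<times> nat) \<Rightarrow>\<^sub>0 'k) \<Rightarrow> (jordan_gen, 'k) free_algebra \<Rightarrow> (nat \<times> nat) \<Rightarrow>\<^sub>0 'k::field_char_0" where
  "free_act P = lin_ext pm_scale (word_act P)"

lemma nf_mult_add: "nf_mult g (P + Q) = nf_mult g P + nf_mult g Q"
  and nf_mult_scale: "nf_mult g (pm_scale c P) = pm_scale c (nf_mult g P)"
  and nf_mult_0: "nf_mult g 0 = 0"
  by (simp_all add: nf_mult_def pm.lin_ext_add pm.lin_ext_scale)

lemma nf_mult_diff: "nf_mult g (P - Q) = nf_mult g P - nf_mult g Q"
  using nf_mult_add[of g "P - Q" Q] by (simp add: algebra_simps)

lemma nf_mult_single: "nf_mult g (Poly_Mapping.single x c) = pm_scale c (nf_step g x)"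
  by (simp add: nf_mult_def)

lemma word_act_add: "word_act (P + Q) w = word_act P w + word_act Q w"
proof -
  have "foldl (\<lambda>Q g. nf_mult g Q) (P + Q) xs =
      foldl (\<lambda>Q g. nf_mult g Q) P xs + foldl (\<lambda>Q g. nf_mult g Q) Q xs" for xs
    by (induction xs arbitrary: P Q) (simp_all add: nf_mult_add)
  then show ?thesis by (simp add: word_act_def)
qed

lemma word_act_scale: "word_act (pm_scale c P) w = pm_scale c (word_act P w)"
proof -
  have "foldl (\<lambda>Q g. nf_mult g Q) (pm_scale c P) xs = pm_scale c (foldl (\<lambda>Q g. nf_mult g Q) P xs)" for xs
    by (induction xs arbitrary: P) (simp_all add: nf_mult_scale)
  then show ?thesis by (simp add: word_act_def)
qed

lemma free_act_add: "free_act P (p + q) = free_act P p + free_act P q"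
  and free_act_scale: "free_act P (pm_scale c p) = pm_scale c (free_act P p)"
  and free_act_0: "free_act P 0 = 0"
  by (simp_all add: free_act_def pm.lin_ext_add pm.lin_ext_scale)

lemma free_act_diff: "free_act P (p - q) = free_act P p - free_act P q"
  using free_act_add[of P "p - q" q] by (simp add: algebra_simps)

lemma free_act_add_left: "free_act (P + Q) p = free_act P p + free_act Q p"
  by (simp add: free_act_def word_act_add[abs_def] pm.lin_ext_fun_add)

lemma free_act_scale_left: "free_act (pm_scale c P) p = pm_scale c (free_act P p)"
  by (simp add: free_act_def word_act_scale[abs_def] pm.lin_ext_fun_scale)

lemma free_act_0_left: "free_act 0 p = 0"
  using free_act_scale_left[of 0 0 p] by simp

lemma free_act_mult: "free_act P (p * q) = free_act (free_act P p) q"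
proof (induction p rule: pm_induct)
  case (2 w c)
  show ?case
  proof (induction q rule: pm_induct)
    case (2 w' d)
    have "word_act P (w + w') = word_act (word_act P w) w'"
      by (simp add: word_act_def plus_free_monoid_def)
    then show ?case
      by (simp add: free_act_def mult_single word_act_scale mult.commute)
  qed (simp_all add: free_act_0 distrib_left free_act_add)
qed (simp_all add: free_act_0 free_act_0_left distrib_right free_act_add free_act_add_left)

lemma free_act_gen: "free_act P (gen g) = nf_mult g P"
  by (simp add: free_act_def gen_def word_act_def)

lemma free_act_1: "free_act P 1 = P"
proof -
  have "free_act P (Poly_Mapping.single 0 1) = P"
    unfolding free_act_def pm.lin_ext_single by (simp add: word_act_def zero_free_monoid_def)
  then show ?thesis by simp
qed

text \<open>Since \<open>nf_mult\<close> is right multiplication, this is P (u v - v u) = P v^2. For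
  P = u^i v^j the terms u^i v^(j+2) on the left have coefficients -j and -(j+1).\<close>

lemma nf_mult_relation:
  "nf_mult Gen_v (nf_mult Gen_u P) - nf_mult Gen_u (nf_mult Gen_v P) = nf_mult Gen_v (nf_mult Gen_v P)"
proof (induction P rule: pm_induct)
  case (2 x c)
  obtain i j where "x = (i, j)" by (cases x)
  then show ?case
    by (intro poly_mapping_eqI)
      (auto simp: nf_mult_single nf_mult_scale nf_mult_diff pm.scale_right_diff_distrib
        lookup_minus lookup_single when_def algebra_simps)
qed (simp_all add: nf_mult_0 nf_mult_add algebra_simps)

lemma free_act_jordan_ideal: "p \<in> jordan_ideal \<Longrightarrow> free_act P p = 0"
proof -
  \<comment> \<open>Quantifying over all \<open>P\<close> makes this annihilator closed under left
    multiplication as well.\<close>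
  have "two_sided_ideal {p. \<forall>P. free_act P p = (0 :: (nat \<times> nat) \<Rightarrow>\<^sub>0 'a)}"
    by (auto simp: two_sided_ideal_def free_act_0 free_act_0_left free_act_add free_act_mult)
  moreover have "free_act P (gen Gen_u * gen Gen_v - gen Gen_v * gen Gen_u - gen Gen_v ^ 2) = 0" for P :: "(nat \<times> nat) \<Rightarrow>\<^sub>0 'a"
    using nf_mult_relation[of P]
    by (simp add: free_act_diff free_act_mult free_act_gen power2_eq_square)
  ultimately have "jordan_ideal \<subseteq> {p. \<forall>P. free_act P p = (0 :: (nat \<times> nat) \<Rightarrow>\<^sub>0 'a)}"
    unfolding jordan_ideal_def by (intro hull_minimal) auto
  then show "p \<in> jordan_ideal \<Longrightarrow> free_act P p = 0" by auto
qed

lift_definition R_act :: "((nat \<times> nat) \<Rightarrow>\<^sub>0 'k) \<Rightarrow> 'k::field_char_0 jordan \<Rightarrow> (nat \<times> nat) \<Rightarrow>\<^sub>0 'k" is free_act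
  using free_act_jordan_ideal free_act_diff by (metis eq_iff_diff_eq_0)

lemma R_act_add: "R_act P (x + y) = R_act P x + R_act P y"
  by transfer (rule free_act_add)

lemma R_act_scale: "R_act P (R_scale c x) = pm_scale c (R_act P x)"
  by transfer (rule free_act_scale)

lemma R_act_mult: "R_act P (x * y) = R_act (R_act P x) y"
  by transfer (rule free_act_mult)

lemma R_act_1: "R_act P 1 = P"
  by transfer (rule free_act_1)

lemma R_act_u: "R_act P R_u = nf_mult Gen_u P"
  by (simp add: R_u_def R_act.abs_eq free_act_gen)

lemma R_act_v: "R_act P R_v = nf_mult Gen_v P"
  by (simp add: R_v_def R_act.abs_eq free_act_gen)

section \<open>Cancellation of u on the right\<close>

lemma lookup_nf_mult_u:
  "Poly_Mapping.lookup (nf_mult Gen_u P) (Suc i, j) = Poly_Mapping.lookup P (i, j) -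
    (if j = 0 then 0 else of_nat (j - 1) * Poly_Mapping.lookup P (Suc i, j - 1))"
proof (induction P rule: pm_induct)
  case (2 x c)
  obtain i' j' where "x = (i', j')" by (cases x)
  then show ?case
    by (cases j) (auto simp: nf_mult_single lookup_minus lookup_single when_def)
next
  case (3 P Q)
  show ?case unfolding nf_mult_add lookup_add 3 by (simp add: algebra_simps)
qed (simp add: nf_mult_0)

text \<open>Comparing coefficients expresses the entry of \<open>P\<close> at (i, j) by the one at
  (i+1, j-1), so induction on j kills every entry.\<close>

lemma nf_mult_u_eq_0D:
  assumes "nf_mult Gen_u P = 0"
  shows "P = 0"
proof -
  have *: "Poly_Mapping.lookup P (i, j) =
      (if j = 0 then 0 else of_nat (j - 1) * Poly_Mapping.lookup P (Suc i, j - 1))" for i j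
    using lookup_nf_mult_u[of P i j] assms by simp
  have "Poly_Mapping.lookup P (i, j) = 0" for i j
  proof (induction j arbitrary: i)
    case 0
    show ?case by (subst *) simp
  next
    case (Suc j)
    show ?case by (subst *) (simp add: Suc)
  qed
  then show ?thesis by (intro poly_mapping_eqI) auto
qed

definition R_coeffs :: "'k::field_char_0 jordan \<Rightarrow> (nat \<times> nat) \<Rightarrow>\<^sub>0 'k" where
  "R_coeffs = R_act (Poly_Mapping.single (0, 0) 1)"

lemma R_coeffs_add: "R_coeffs (x + y) = R_coeffs x + R_coeffs y"
  and R_coeffs_scale: "R_coeffs (R_scale c x) = pm_scale c (R_coeffs x)"
  by (simp_all add: R_coeffs_def R_act_add R_act_scale)

lemma R_coeffs_0: "R_coeffs 0 = 0"
  using R_coeffs_scale[of 0 0] by simp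

lemma R_coeffs_mult_u: "R_coeffs (x * R_u) = nf_mult Gen_u (R_coeffs x)"
  by (simp add: R_coeffs_def R_act_mult R_act_u)

lemma R_coeffs_monom: "R_coeffs (R_u ^ i * R_v ^ j :: 'k::field_char_0 jordan) = Poly_Mapping.single (i, j) 1"
proof (induction j)
  case 0
  have "R_coeffs (R_u ^ i :: 'k jordan) = Poly_Mapping.single (i, 0) 1"
    by (induction i) (simp_all add: R_coeffs_def R_act_1 R_act_mult R_act_u nf_mult_single power_Suc2 del: power_Suc)
  then show ?case by simp
next
  case (Suc j)
  have "R_coeffs (R_u ^ i * R_v ^ Suc j) = nf_mult Gen_v (R_coeffs (R_u ^ i * R_v ^ j :: 'k jordan))"
    unfolding power_Suc2 mult.assoc[symmetric] R_coeffs_def R_act_mult R_act_v ..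
  then show ?case using Suc by (simp add: nf_mult_single)
qed

section \<open>Coefficient functionals modulo u R and modulo R u\<close>

lemma jordan_induct:
  assumes "P 1" "P R_u" "P R_v" "\<And>x y. P x \<Longrightarrow> P y \<Longrightarrow> P (x * y)"
    "\<And>x y. P x \<Longrightarrow> P y \<Longrightarrow> P (x + y)" "\<And>c x. P x \<Longrightarrow> P (R_scale c x)"
  shows "P z"
proof -
  have g: "P (abs_jordan (gen g))" for g
    using assms(2,3) by (cases g) (simp_all add: R_u_def R_v_def)
  have "P (abs_jordan p)" for p
    by (induction p rule: free_algebra_induct)
      (metis assms(1,4-6) g one_jordan.abs_eq times_jordan.abs_eq plus_jordan.abs_eq R_scale.abs_eq)+
  then show ?thesis by (cases z rule: jordan_abs_cases) simp
qed

text \<open>The polynomials without pure powers of \<open>v\<close> represent the right ideal \<open>u R\<close>.\<close>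

lemma lookup_R_act_0:
  assumes "\<And>j. Poly_Mapping.lookup P (0, j) = 0"
  shows "Poly_Mapping.lookup (R_act P x) (0, j) = 0"
proof -
  define V where "V = {P :: (nat \<times> nat) \<Rightarrow>\<^sub>0 'a. \<forall>j. Poly_Mapping.lookup P (0, j) = 0}"
  \<comment> \<open>A factor u^i with i > 0 stays in front, so the coefficient of v^j in the product
    only sees that of v^(j-1) in \<open>P\<close>.\<close>
  have *: "Poly_Mapping.lookup (nf_mult g P) (0, j) =
      (if j = 0 then 0 else Poly_Mapping.lookup P (0, j - 1) * (case g of Gen_u \<Rightarrow> - of_nat (j - 1) | Gen_v \<Rightarrow> 1))"
    for g j and P :: "(nat \<times> nat) \<Rightarrow>\<^sub>0 'a"
  proof (induction P rule: pm_induct)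
    case (2 x c)
    obtain i' j' where "x = (i', j')" by (cases x)
    then show ?case
      by (cases j; cases g) (auto simp: nf_mult_single lookup_minus lookup_single when_def)
  qed (auto simp: nf_mult_0 nf_mult_add lookup_add algebra_simps split: jordan_gen.splits)
  have "\<forall>P\<in>V. R_act P x \<in> V"
  proof (induction x rule: jordan_induct)
    case (4 x y)
    then show ?case by (simp add: R_act_mult)
  qed (auto simp: V_def R_act_1 R_act_u R_act_v R_act_add R_act_scale lookup_add *)
  then show ?thesis using assms by (auto simp: V_def)
qed

lemma lookup_R_coeffs_u_mult: "Poly_Mapping.lookup (R_coeffs (R_u * x)) (0, j) = 0"
  unfolding R_coeffs_def R_act_mult R_act_u nf_mult_single
  by (rule lookup_R_act_0) (simp add: lookup_minus lookup_single)

text \<open>\<open>R / R u\<close> has the basis of the powers of \<open>v\<close>, and \<open>u v\<^sup>n = v\<^sup>n u + n v\<^bsup>n+1\<^esup>\<close>. Hence \<open>u\<^sup>i v\<^sup>j\<close> is congruent to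
  \<open>j (j + 1) \<dots> (j + i - 1) v\<^bsup>i+j\<^esup>\<close>, and \<open>right_weight N\<close> reads off the coefficient of \<open>v\<^sup>N\<close>.\<close>

definition right_weight :: "nat \<Rightarrow> 'k::field_char_0 jordan \<Rightarrow> 'k" where
  "right_weight N x =
     lin_ext (*) (\<lambda>(i, j). if i + j = N then pochhammer (of_nat j) i else 0) (R_coeffs x)"

lemma right_weight_add: "right_weight N (x + y) = right_weight N x + right_weight N y"
  and right_weight_scale: "right_weight N (R_scale c x) = c * right_weight N x"
  by (simp_all add: right_weight_def R_coeffs_add R_coeffs_scale ground.lin_ext_add ground.lin_ext_scale)

lemma right_weight_v: "right_weight N (R_v ^ N) = (1 :: 'k::field_char_0)"
proof -
  have "R_coeffs (R_v ^ N :: 'k jordan) = Poly_Mapping.single (0, N) 1"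
    using R_coeffs_monom[of 0 N] by simp
  then show ?thesis by (simp add: right_weight_def)
qed

text \<open>For u^i v^j u = u^(i+1) v^j - j u^i v^(j+1) the two weights cancel, by
  \<open>pochhammer j (i+1) = j * pochhammer (j+1) i\<close>.\<close>

lemma right_weight_mult_u: "right_weight N (x * R_u) = 0"
proof -
  have "lin_ext (*) (\<lambda>(i, j). if i + j = N then pochhammer (of_nat j) i else 0) (nf_mult Gen_u P) = 0"
    for P :: "(nat \<times> nat) \<Rightarrow>\<^sub>0 'a"
  proof (induction P rule: pm_induct)
    case (2 y c)
    obtain i j where y: "y = (i, j)" by (cases y)
    have "lin_ext (*) f (p - q) = lin_ext (*) f p - lin_ext (*) f q" for f and p q :: "(nat \<times> nat) \<Rightarrow>\<^sub>0 'a"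
      using ground.lin_ext_add[of f "p - q" q] by (simp add: algebra_simps)
    then show ?case
      by (simp add: y nf_mult_single ground.lin_ext_scale pochhammer_rec add.commute)
  qed (simp_all add: nf_mult_0 nf_mult_add ground.lin_ext_add)
  then show ?thesis by (simp add: right_weight_def R_coeffs_mult_u)
qed

lemma finite_right_weight: "finite {N. right_weight N x \<noteq> 0}"
proof (rule finite_subset)
  show "finite ((\<lambda>(i, j). i + j) ` Poly_Mapping.keys (R_coeffs x))" by simp
  show "{N. right_weight N x \<noteq> 0} \<subseteq> (\<lambda>(i, j). i + j) ` Poly_Mapping.keys (R_coeffs x)"
  proof safe
    fix N assume "right_weight N x \<noteq> 0"
    then obtain y where "y \<in> Poly_Mapping.keys (R_coeffs x)"
      "(case y of (i, j) \<Rightarrow> if i + j = N then pochhammer (of_nat j :: 'a) i else 0) \<noteq> 0"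
      unfolding right_weight_def lin_ext_def by (metis (no_types, lifting) mult_zero_right sum.neutral)
    then show "N \<in> (\<lambda>(i, j). i + j) ` Poly_Mapping.keys (R_coeffs x)"
      by (force split: prod.splits if_splits)
  qed
qed

lemma finite_lookup_R_coeffs: "finite {N. Poly_Mapping.lookup (R_coeffs x) (0, N) \<noteq> 0}"
proof (rule finite_subset)
  show "finite (snd ` Poly_Mapping.keys (R_coeffs x))" by simp
  show "{N. Poly_Mapping.lookup (R_coeffs x) (0, N) \<noteq> 0} \<subseteq> snd ` Poly_Mapping.keys (R_coeffs x)"
    by (force simp: in_keys_iff)
qed

section \<open>The defining relations of the image of \<open>\<lambda>\<^sub>0\<close>\<close>

text \<open>The basis is shifted, \<open>U_E p = e\<^bsub>p+1\<^esub>\<close>, so that \<open>\<lambda>\<^sub>a\<close> maps \<open>U_E p\<close> to \<open>(u - p a v) v\<^sup>p\<close>.\<close>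

definition U_E :: "nat \<Rightarrow> 'k::field_char_0 U_witt" where
  "U_E p = U_e (Suc p)"

definition comm :: "'a::ring_1 \<Rightarrow> 'a \<Rightarrow> 'a" where
  "comm x y = x * y - y * x"

lemma comm_add: "comm x (y + z) = comm x y + comm x z"
  and comm_diff: "comm x (y - z) = comm x y - comm x z"
  and comm_mult: "comm x (y * z) = comm x y * z + y * comm x z"
  by (simp_all add: comm_def algebra_simps)

lemma comm_U_scale: "comm x (U_scale c y) = U_scale c (comm x y)"
  by (simp add: comm_def U.scale_mult_left U.scale_mult_right U.scale_right_diff_distrib)

lemma comm_U_E: "comm (U_E p) (U_E q) = U_scale (of_nat q - of_nat p) (U_E (Suc (p + q)))"
proof -
  have "posnat (Suc p) + posnat (Suc q) = posnat (Suc (Suc (p + q)))"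
    by (simp add: plus_posnat_def posnat_inverse)
  then show ?thesis
    by (simp add: comm_def U_E_def U_e_def U_incl_bracket witt_bracket_basis posnat_inverse U_incl_scale)
qed

lemma U_induct_E:
  assumes "P 1" "\<And>p. P (U_E p)" "\<And>x y. P x \<Longrightarrow> P y \<Longrightarrow> P (x * y)"
    "\<And>x y. P x \<Longrightarrow> P y \<Longrightarrow> P (x + y)" "\<And>c x. P x \<Longrightarrow> P (U_scale c x)"
  shows "P z"
proof (induction z rule: U_induct)
  case (2 x)
  show ?case
  proof (induction x rule: pm_induct)
    case 1
    have "P (U_scale 0 1)" using assms by blast
    then show ?case using U_incl_scale[of "0 :: 'a" 0] by simp
  next
    case (2 n c)
    have "witt_basis n = (witt_basis (posnat (Suc (nat_of n - 1))) :: 'a witt)"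
      using nat_of_ge_1[of n] by (simp add: nat_of_inverse)
    then have "U_incl (witt_basis n) = (U_E (nat_of n - 1) :: 'a U_witt)"
      by (simp add: U_E_def U_e_def)
    then have "U_incl (Poly_Mapping.single n c) = U_scale c (U_E (nat_of n - 1))"
      using U_incl_scale[of c "witt_basis n"] by (simp add: witt_basis_def)
    then show ?case using assms by simp
  qed (simp add: U_incl_add assms)
qed (use assms in auto)

text \<open>In R, u v^p u v^q = u^2 v^(p+q) - p u v^(p+q+1), so \<lambda>_0 kills these
  elements.\<close>

definition shift_rel :: "nat \<Rightarrow> nat \<Rightarrow> 'k::field_char_0 U_witt" where
  "shift_rel p q = U_E p * U_E q - U_E 0 * U_E (p + q) + U_scale (of_nat p) (U_E (Suc (p + q)))"

lemma shift_rel_sym: "shift_rel p q = shift_rel q p"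
proof -
  have "shift_rel p q - shift_rel q p =
      comm (U_E p) (U_E q) + U_scale (of_nat p - of_nat q) (U_E (Suc (p + q)) :: 'a U_witt)"
    by (simp add: shift_rel_def comm_def add.commute U.scale_left_diff_distrib)
  also have "\<dots> = 0" by (simp add: comm_U_E U.scale_left_diff_distrib)
  finally show ?thesis by simp
qed

lemma comm_E0_shift_rel:
  "comm (U_E 0) (shift_rel p q) =
     U_scale (of_nat p) (shift_rel (Suc p) q) + U_scale (of_nat q) (shift_rel p (Suc q))"
  by (simp add: shift_rel_def comm_add comm_diff comm_mult comm_U_scale comm_U_E
      U.scale_right_distrib U.scale_right_diff_distrib U.scale_left_distrib
      U.scale_mult_left U.scale_mult_right algebra_simps)

lemma U_scale_2: "U_scale 2 x = x + x"
  using U.scale_left_distrib[of 1 1 x] by simp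

lemma comm_E1_shift_rel:
  "comm (U_E 1) (shift_rel 1 q) =
     U_scale (of_nat q - 1) (shift_rel 1 (Suc (Suc q))) + shift_rel 2 (Suc q)"
  by (simp add: shift_rel_def comm_add comm_diff comm_mult comm_U_scale comm_U_E
      U.scale_right_distrib U.scale_right_diff_distrib U.scale_left_distrib U.scale_left_diff_distrib
      U.scale_mult_left U.scale_mult_right algebra_simps numeral_2_eq_2 U_scale_2)

definition r_ideal :: "'k::field_char_0 U_witt set" where
  "r_ideal = two_sided_ideal hull {U_e 1 * U_e 3 - U_e 2 ^ 2 - U_e 4}"

lemma two_sided_r_ideal: "two_sided_ideal r_ideal"
  unfolding r_ideal_def by (rule two_sided_ideal_hull)

lemmas r_ideal_add = two_sided_ideal_add[OF two_sided_r_ideal]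
  and r_ideal_diff = two_sided_ideal_diff[OF two_sided_r_ideal]
  and r_ideal_0 = two_sided_ideal_0[OF two_sided_r_ideal]
  and r_ideal_mult_left = two_sided_ideal_mult_left[OF two_sided_r_ideal]
  and r_ideal_mult_right = two_sided_ideal_mult_right[OF two_sided_r_ideal]

lemma r_ideal_scale: "x \<in> r_ideal \<Longrightarrow> U_scale c x \<in> r_ideal"
  using r_ideal_mult_left[of x "U_scale c 1"] by (simp add: U.scale_mult_left)

lemma r_ideal_scaleD: "U_scale c x \<in> r_ideal \<Longrightarrow> c \<noteq> 0 \<Longrightarrow> x \<in> r_ideal"
  using r_ideal_scale[of "U_scale c x" "inverse c"] by simp

lemma r_ideal_comm: "x \<in> r_ideal \<Longrightarrow> comm y x \<in> r_ideal"
  by (simp add: comm_def r_ideal_diff r_ideal_mult_left r_ideal_mult_right)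

text \<open>Both \<open>comm (U_E 0) (shift_rel 1 q)\<close> and
  \<open>comm (U_E 1) (shift_rel 1 (q - 1))\<close> contain \<open>shift_rel 2 q\<close> once, and
  their coefficients at \<open>shift_rel 1 (Suc q)\<close> are q and q - 2. The difference leaves
  twice the wanted element, and 2 is invertible.\<close>

lemma shift_rel_1_in_r_ideal: "shift_rel 1 (Suc q) \<in> (r_ideal :: 'k::field_char_0 U_witt set)"
proof (induction q rule: less_induct)
  case (less q)
  consider "q = 0" | "q = 1" | t where "q = Suc (Suc t)" by (metis One_nat_def not0_implies_Suc)
  then show ?case
  proof cases
    case 1
    have "(U_e 1 * U_e 3 - U_e 2 ^ 2 - U_e 4 :: 'k U_witt) \<in> r_ideal"
      unfolding r_ideal_def by (rule hull_inc) simp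
    moreover have "shift_rel 1 1 = - (U_e 1 * U_e 3 - U_e 2 ^ 2 - U_e 4 :: 'k U_witt)"
      by (simp add: shift_rel_def U_E_def power2_eq_square numeral_2_eq_2 numeral_3_eq_3 eval_nat_numeral algebra_simps)
    ultimately show ?thesis
      using 1 two_sided_ideal_uminus[OF two_sided_r_ideal] by (metis One_nat_def)
  next
    case 2
    \<comment> \<open>Here the two terms of the commutator coincide by symmetry, so one commutator
      suffices.\<close>
    have "comm (U_E 0) (shift_rel 1 1) \<in> (r_ideal :: 'k U_witt set)"
      using less[of 0] 2 r_ideal_comm by simp
    also have "comm (U_E 0) (shift_rel 1 1) = U_scale 2 (shift_rel 1 2 :: 'k U_witt)"
      by (simp add: U_scale_2 comm_E0_shift_rel shift_rel_sym[of "Suc (Suc 0)"] numeral_2_eq_2)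
    finally show ?thesis using 2 r_ideal_scaleD[of "2 :: 'k"] by (simp add: numeral_2_eq_2)
  next
    case 3
    let ?D = "shift_rel 1 (Suc q) :: 'k U_witt"
    have "comm (U_E 0) (shift_rel 1 q) - comm (U_E 1) (shift_rel 1 (q - 1)) \<in> (r_ideal :: 'k U_witt set)"
      using less[of "q - 1"] less[of "q - 2"] 3 by (intro r_ideal_diff r_ideal_comm) simp_all
    also have "comm (U_E 0) (shift_rel 1 q) = shift_rel 2 q + U_scale (of_nat q) ?D"
      by (simp add: comm_E0_shift_rel numeral_2_eq_2)
    also have "comm (U_E 1) (shift_rel 1 (q - 1)) = U_scale (of_nat q - 2) ?D + shift_rel 2 q"
      using 3 comm_E1_shift_rel[of "q - 1"] by simp
    also have "shift_rel 2 q + U_scale (of_nat q) ?D - (U_scale (of_nat q - 2) ?D + shift_rel 2 q) = U_scale 2 ?D"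
      by (simp add: U.scale_left_diff_distrib)
    finally show ?thesis using r_ideal_scaleD[of "2 :: 'k"] by simp
  qed
qed

text \<open>The commutator with \<open>U_E 0\<close> gives p times
  \<open>shift_rel (Suc p) q\<close>, up to a multiple of \<open>shift_rel p (Suc q)\<close>; hence
  q varies in the induction. Dividing by p needs p > 0, so first index 1 comes from the previous
  lemma.\<close>

lemma shift_rel_in_r_ideal: "shift_rel p q \<in> (r_ideal :: 'k::field_char_0 U_witt set)"
proof (cases "q = 0")
  case True
  have "shift_rel 0 p = (0 :: 'k U_witt)" by (simp add: shift_rel_def)
  then show ?thesis using True r_ideal_0 shift_rel_sym by metis
next
  case False
  then show ?thesis
  proof (induction p arbitrary: q)
    case 0
    show ?case by (simp add: shift_rel_def r_ideal_0)
  next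
    case (Suc p)
    show ?case
    proof (cases "p = 0")
      case True
      then show ?thesis using shift_rel_1_in_r_ideal[of "q - 1"] Suc.prems by simp
    next
      case False
      have "comm (U_E 0) (shift_rel p q) - U_scale (of_nat q) (shift_rel p (Suc q)) \<in> (r_ideal :: 'k U_witt set)"
        using Suc by (intro r_ideal_diff r_ideal_comm r_ideal_scale) auto
      then show ?thesis
        using False r_ideal_scaleD[of "of_nat p :: 'k"] by (simp add: comm_E0_shift_rel)
    qed
  qed
qed

section \<open>The kernels\<close>

lemma lambda_hom_hom: "algebra_hom U_scale R_scale (lambda_hom a)"
  using is_lambda_lambda_hom by (auto simp: is_lambda_def)

lemma lambda_hom_add: "lambda_hom a (x + y) = lambda_hom a x + lambda_hom a y"
  and lambda_hom_scale: "lambda_hom a (U_scale c x) = R_scale c (lambda_hom a x)"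
  and lambda_hom_mult: "lambda_hom a (x * y) = lambda_hom a x * lambda_hom a y"
  and lambda_hom_1: "lambda_hom a 1 = 1"
proof -
  interpret h: Vector_Spaces.linear U_scale R_scale "lambda_hom a"
    using lambda_hom_hom[of a] by (simp add: algebra_hom_def)
  show "lambda_hom a (x + y) = lambda_hom a x + lambda_hom a y"
    "lambda_hom a (U_scale c x) = R_scale c (lambda_hom a x)" by (rule h.add h.scale)+
  show "lambda_hom a (x * y) = lambda_hom a x * lambda_hom a y" "lambda_hom a 1 = 1"
    using lambda_hom_hom[of a] by (auto simp: algebra_hom_def)
qed

lemma lambda_hom_diff: "lambda_hom a (x - y) = lambda_hom a x - lambda_hom a y"
  using lambda_hom_add[of a "x - y" y] by (simp add: algebra_simps)

lemma lambda_hom_0: "lambda_hom a 0 = 0"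
  using lambda_hom_diff[of a 0 0] by simp

lemma lambda_hom_power: "lambda_hom a (x ^ n) = lambda_hom a x ^ n"
  by (induction n) (simp_all add: lambda_hom_1 lambda_hom_mult)

lemma lambda_hom_U_E: "lambda_hom a (U_E p) = lambda_e a (Suc p)"
  using is_lambda_lambda_hom by (auto simp: is_lambda_def U_E_def)

lemma lambda_e_Suc: "lambda_e a (Suc p) = R_u * R_v ^ p - R_scale (of_nat p * a) (R_v ^ Suc p)"
  by (simp add: lambda_e_def left_diff_distrib R.scale_mult_left)

text \<open>The generator is mapped to a (1 - a) v^4.\<close>

lemma r_ideal_subset_kernel:
  fixes a :: "'k::field_char_0"
  assumes "a * (a - 1) = 0"
  shows "r_ideal \<subseteq> {x. lambda_hom a x = 0}"
proof -
  have [simp]: "a * a = a" using assms by (simp add: algebra_simps)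
  have "two_sided_ideal {x. lambda_hom a x = 0}"
    by (auto simp: two_sided_ideal_def lambda_hom_0 lambda_hom_add lambda_hom_mult)
  moreover have "lambda_hom a (U_e 1 * U_e 3 - U_e 2 ^ 2 - U_e 4) = 0"
  proof -
    have "lambda_hom a (U_e 1 * U_e 3 - U_e 2 ^ 2 - U_e 4)
        = lambda_e a (Suc 0) * lambda_e a (Suc 2) - lambda_e a (Suc 1) * lambda_e a (Suc 1) - lambda_e a (Suc 3)"
      using is_lambda_lambda_hom[of a]
      by (simp add: lambda_hom_diff lambda_hom_mult power2_eq_square is_lambda_def numeral_eq_Suc)
    also have "\<dots> = 0"
      unfolding lambda_e_mult unfolding lambda_e_Suc
      by (simp add: R.scale_left_distrib R.scale_left_diff_distrib distrib_left distrib_right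
          eval_nat_numeral algebra_simps)
    finally show ?thesis .
  qed
  ultimately show ?thesis
    unfolding r_ideal_def by (intro hull_minimal) auto
qed

text \<open>A linear choice of preimages under \<lambda>_0 for 1 and the monomials u^i v^j with i >
  0. Pure powers v^j with j > 0 do not occur in the image of \<lambda>_0; the value 1 there is a
  default.\<close>

definition U_section :: "((nat \<times> nat) \<Rightarrow>\<^sub>0 'k) \<Rightarrow> 'k::field_char_0 U_witt" where
  "U_section = lin_ext U_scale (\<lambda>(i, j). if i = 0 then 1 else U_E 0 ^ (i - 1) * U_E j)"

definition U_spanning :: "'k::field_char_0 U_witt set" where
  "U_spanning = r_ideal \<union> {1} \<union> {U_E 0 ^ k * U_E n | k n. True}"

lemma U_spanning_intros:
  "x \<in> r_ideal \<Longrightarrow> x \<in> U.span U_spanning" "1 \<in> U.span U_spanning"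
  "U_E 0 ^ k * U_E n \<in> U.span U_spanning"
  by (rule U.span_base, auto simp: U_spanning_def)+

lemma mult_left_span_U:
  assumes "\<And>g. g \<in> G \<Longrightarrow> y * g \<in> U.span G" "x \<in> U.span G"
  shows "y * x \<in> U.span G"
proof (rule U.span_induct[OF assms(2)])
  show "U.subspace {x. y * x \<in> U.span G}"
    by (auto simp: U.subspace_def distrib_left U.scale_mult_right U.span_zero
        intro: U.span_add U.span_scale)
qed (use assms(1) in auto)

text \<open>Each step moves \<open>U_E p\<close> past one \<open>U_E 0\<close> at the cost of a term
  with \<open>U_E (Suc p)\<close>, so p varies in the induction; at the end
  \<open>shift_rel p q\<close> rewrites \<open>U_E p * U_E q\<close>.\<close>

lemma U_E_power_mult_in_span: "U_E p * (U_E 0 ^ k * U_E q) \<in> U.span U_spanning"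
proof (induction k arbitrary: p)
  case 0
  have "U_E p * U_E q = shift_rel p q + U_E 0 ^ 1 * U_E (p + q) - U_scale (of_nat p) (U_E 0 ^ 0 * U_E (Suc (p + q)))"
    by (simp add: shift_rel_def)
  also have "\<dots> \<in> U.span U_spanning"
    by (intro U.span_diff U.span_add U.span_scale U_spanning_intros shift_rel_in_r_ideal)
  finally show ?case by simp
next
  case (Suc k)
  have E0: "U_E 0 * x \<in> U.span U_spanning" if "x \<in> U.span U_spanning" for x :: "'a U_witt"
  proof (rule mult_left_span_U[OF _ that])
    fix g :: "'a U_witt" assume "g \<in> U_spanning"
    then consider "g \<in> r_ideal" | "g = 1" | k n where "g = U_E 0 ^ k * U_E n"
      by (auto simp: U_spanning_def)
    then show "U_E 0 * g \<in> U.span U_spanning"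
    proof cases
      case 1
      then show ?thesis by (intro U_spanning_intros r_ideal_mult_left)
    next
      case 2
      then show ?thesis using U_spanning_intros(3)[of 0 0] by simp
    next
      case (3 k n)
      then show ?thesis using U_spanning_intros(3)[of "Suc k" n] by (simp add: mult.assoc)
    qed
  qed
  let ?y = "U_E 0 ^ k * U_E q"
  have "U_E p * (U_E 0 ^ Suc k * U_E q) = (U_E p * U_E 0) * ?y" by (simp add: mult.assoc)
  also have "U_E p * U_E 0 = shift_rel p 0 + U_E 0 * U_E p - U_scale (of_nat p) (U_E (Suc p) :: 'a U_witt)"
    by (simp add: shift_rel_def)
  also have "\<dots> * ?y = shift_rel p 0 * ?y + U_E 0 * (U_E p * ?y) - U_scale (of_nat p) (U_E (Suc p) * ?y)"
    by (simp add: distrib_right left_diff_distrib U.scale_mult_left mult.assoc)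
  also have "\<dots> \<in> U.span U_spanning"
    by (intro U.span_diff U.span_add U.span_scale U_spanning_intros(1) r_ideal_mult_right
        shift_rel_in_r_ideal E0 Suc.IH)
  finally show ?case .
qed

text \<open>The span is stable under left multiplication by the generators, hence a left ideal, and
  it contains 1.\<close>

lemma span_U_spanning: "x \<in> U.span U_spanning"
proof -
  have "\<forall>y\<in>U.span U_spanning. x * y \<in> U.span U_spanning"
  proof (induction x rule: U_induct_E)
    case (2 p)
    have "U_E p * g \<in> U.span U_spanning" if g: "g \<in> U_spanning" for g :: "'a U_witt"
    proof -
      consider "g \<in> r_ideal" | "g = 1" | k n where "g = U_E 0 ^ k * U_E n"
        using g by (auto simp: U_spanning_def)
      then show ?thesis
      proof cases
        case 1
        then show ?thesis by (intro U_spanning_intros r_ideal_mult_left)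
      next
        case 2
        then show ?thesis using U_spanning_intros(3)[of 0 p] by simp
      next
        case (3 k n)
        then show ?thesis by (simp only: U_E_power_mult_in_span)
      qed
    qed
    then show ?case by (blast intro: mult_left_span_U)
  next
    case (3 x y)
    then show ?case by (simp add: mult.assoc)
  next
    case (4 x y)
    then show ?case by (simp add: distrib_right U.span_add)
  next
    case (5 c x)
    then show ?case by (simp add: U.scale_mult_left U.span_scale)
  qed simp
  then show ?thesis using U_spanning_intros(2) by force
qed

text \<open>\<open>U_section\<close> inverts \<open>\<lambda>\<^sub>0\<close> modulo \<open>r_ideal\<close>, because \<open>\<lambda>\<^sub>0\<close> maps the spanning vector
  \<open>e\<^sub>1\<^sup>k e\<^bsub>n+1\<^esub>\<close> to the monomial \<open>u\<^bsup>k+1\<^esup> v\<^sup>n\<close>.\<close>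

lemma U_section_lambda_0: "x - U_section (R_coeffs (lambda_hom 0 x)) \<in> r_ideal"
proof (rule U.span_induct[OF span_U_spanning[of x]])
  show "U.subspace {x :: 'a U_witt. x - U_section (R_coeffs (lambda_hom 0 x)) \<in> r_ideal}"
    unfolding U.subspace_def
  proof (intro conjI ballI allI; unfold mem_Collect_eq)
    fix x y :: "'a U_witt" and c :: 'a
    assume x: "x - U_section (R_coeffs (lambda_hom 0 x)) \<in> r_ideal"
    then have "U_scale c (x - U_section (R_coeffs (lambda_hom 0 x))) \<in> r_ideal"
      by (rule r_ideal_scale)
    then show "U_scale c x - U_section (R_coeffs (lambda_hom 0 (U_scale c x))) \<in> r_ideal"
      by (simp add: U_section_def lambda_hom_scale R_coeffs_scale U.lin_ext_scale U.scale_right_diff_distrib)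
    assume "y - U_section (R_coeffs (lambda_hom 0 y)) \<in> r_ideal"
    from r_ideal_add[OF x this]
    show "x + y - U_section (R_coeffs (lambda_hom 0 (x + y))) \<in> r_ideal"
      by (simp add: U_section_def lambda_hom_add R_coeffs_add U.lin_ext_add algebra_simps)
  qed (simp add: lambda_hom_0 R_coeffs_0 U_section_def r_ideal_0)
next
  fix g :: "'a U_witt" assume "g \<in> U_spanning"
  then consider "g \<in> r_ideal" | "g = 1" | k n where "g = U_E 0 ^ k * U_E n"
    by (auto simp: U_spanning_def)
  then show "g - U_section (R_coeffs (lambda_hom 0 g)) \<in> r_ideal"
  proof cases
    case 1
    then have "lambda_hom 0 g = 0" using r_ideal_subset_kernel[of "0 :: 'a"] by auto
    then show ?thesis using 1 by (simp add: R_coeffs_0 U_section_def)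
  next
    case 2
    have "R_coeffs (lambda_hom 0 g) = Poly_Mapping.single (0, 0) 1"
      using R_coeffs_monom[of 0 0] by (simp add: 2 lambda_hom_1)
    then show ?thesis by (simp add: 2 U_section_def r_ideal_0)
  next
    case (3 k n)
    have "lambda_hom 0 g = R_u ^ Suc k * R_v ^ n"
      unfolding 3 lambda_hom_mult lambda_hom_power lambda_hom_U_E lambda_e_Suc
      by (simp add: power_Suc2 mult.assoc del: power_Suc)
    then show ?thesis by (simp add: 3 R_coeffs_monom U_section_def r_ideal_0 del: power_Suc)
  qed
qed

lemma kernel_lambda_0: "{x. lambda_hom (0 :: 'k::field_char_0) x = 0} = r_ideal"
proof
  show "{x. lambda_hom (0 :: 'k) x = 0} \<subseteq> r_ideal"
  proof safe
    fix x :: "'k U_witt" assume "lambda_hom 0 x = 0"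
    then show "x \<in> r_ideal"
      using U_section_lambda_0[of x] by (simp add: R_coeffs_0 U_section_def)
  qed
qed (use r_ideal_subset_kernel[of 0] in auto)

text \<open>On generators, (u - p v) v^p = v^p u, so both sides are u v^p u; the identity then
  passes to products.\<close>

lemma u_lambda_1: "R_u * lambda_hom 1 x = lambda_hom 0 x * R_u"
proof (induction x rule: U_induct_E)
  case (2 p)
  show ?case
    by (simp add: lambda_hom_U_E lambda_e_Suc mult.assoc R_vu right_diff_distrib R.scale_mult_right)
next
  case (3 x y)
  have "R_u * lambda_hom 1 (x * y) = (R_u * lambda_hom 1 x) * lambda_hom 1 y"
    by (simp add: lambda_hom_mult mult.assoc)
  also have "\<dots> = lambda_hom 0 (x * y) * R_u" by (simp add: 3 lambda_hom_mult mult.assoc)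
  finally show ?case .
qed (simp_all add: lambda_hom_1 lambda_hom_add lambda_hom_scale distrib_left distrib_right
      R.scale_mult_left R.scale_mult_right)

lemma kernel_lambda_1: "{x. lambda_hom (1 :: 'k::field_char_0) x = 0} = r_ideal"
proof
  show "{x. lambda_hom (1 :: 'k) x = 0} \<subseteq> r_ideal"
  proof safe
    fix x :: "'k U_witt" assume "lambda_hom 1 x = 0"
    then have "nf_mult Gen_u (R_coeffs (lambda_hom 0 x)) = 0"
      using u_lambda_1[of x] R_coeffs_mult_u[of "lambda_hom 0 x"] by (simp add: R_coeffs_0)
    then have "R_coeffs (lambda_hom 0 x) = 0" by (rule nf_mult_u_eq_0D)
    then show "x \<in> r_ideal"
      using U_section_lambda_0[of x] by (simp add: U_section_def)
  qed
qed (use r_ideal_subset_kernel[of 1] in auto)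

section \<open>The derivative of \<open>\<lambda>\<^sub>a\<close> in \<open>a\<close>\<close>

text \<open>The dual numbers \<open>R[\<epsilon>] / (\<epsilon>\<^sup>2)\<close>: the derivative is the \<open>\<epsilon>\<close>-part of \<open>\<lambda>\<^bsub>a+\<epsilon>\<^esub>\<close>.\<close>

datatype 'a dual = Dual (re_part: 'a) (eps_part: 'a)

instantiation dual :: (ring_1) ring_1
begin

definition "0 = Dual 0 0"
definition "1 = Dual 1 0"
definition "x + y = Dual (re_part x + re_part y) (eps_part x + eps_part y)"
definition "x - y = Dual (re_part x - re_part y) (eps_part x - eps_part y)"
definition "- x = Dual (- re_part x) (- eps_part x)"
definition "x * y = Dual (re_part x * re_part y) (eps_part x * re_part y + re_part x * eps_part y)"

instance
  by standard (auto simp: zero_dual_def one_dual_def plus_dual_def minus_dual_def uminus_dual_def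
      times_dual_def algebra_simps)

end

lemma dual_sel [simp]:
  "re_part (x + y) = re_part x + re_part y" "eps_part (x + y) = eps_part x + eps_part y"
  "re_part (x - y) = re_part x - re_part y" "eps_part (x - y) = eps_part x - eps_part y"
  "re_part (x * y) = re_part x * re_part y"
  "eps_part (x * y) = eps_part x * re_part y + re_part x * eps_part y"
  "re_part 1 = 1" "eps_part 1 = 0"
  by (simp_all add: plus_dual_def minus_dual_def times_dual_def one_dual_def)

definition dual_scale :: "'k::field_char_0 \<Rightarrow> 'k jordan dual \<Rightarrow> 'k jordan dual" where
  "dual_scale c x = Dual (R_scale c (re_part x)) (R_scale c (eps_part x))"

lemma dual_scale_sel [simp]:
  "re_part (dual_scale c x) = R_scale c (re_part x)" "eps_part (dual_scale c x) = R_scale c (eps_part x)"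
  by (simp_all add: dual_scale_def)

interpretation dual: k_algebra dual_scale
  by unfold_locales
    (auto intro!: dual.expand simp: R.scale_left_distrib R.scale_right_distrib R.scale_mult_left R.scale_mult_right)

definition lambda_e' :: "nat \<Rightarrow> 'k::field_char_0 jordan" where
  "lambda_e' n = - R_scale (of_nat (n - 1)) (R_v ^ n)"

lemma lambda_e_mult_v:
  "lambda_e a (Suc p) * R_v ^ Suc q = R_u * R_v ^ Suc (p + q) - R_scale (of_nat p * a) (R_v ^ Suc (Suc (p + q)))"
proof -
  have "R_v ^ p * R_v ^ Suc q = (R_v ^ Suc (p + q) :: 'a jordan)"
    by (simp only: power_add[symmetric] add_Suc_right)
  then show ?thesis
    unfolding lambda_e_def by (simp add: mult.assoc left_diff_distrib R.scale_mult_left)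
qed

lemma v_mult_lambda_e:
  "R_v ^ Suc p * lambda_e a (Suc q) =
     R_u * R_v ^ Suc (p + q) - R_scale (of_nat (Suc p) + of_nat q * a) (R_v ^ Suc (Suc (p + q)))"
proof -
  have [simp]: "R_v ^ Suc p * R_v ^ q = (R_v ^ Suc (p + q) :: 'a jordan)"
    "R_v ^ Suc (Suc p) * R_v ^ q = (R_v ^ Suc (Suc (p + q)) :: 'a jordan)"
    "R_v ^ Suc p * (R_v * R_v ^ q) = (R_v ^ Suc (Suc (p + q)) :: 'a jordan)"
    by (simp_all only: power_Suc[symmetric] power_add[symmetric]) simp_all
  have "R_v ^ Suc p * lambda_e a (Suc q) = (R_v ^ Suc p * R_u - R_scale (of_nat q * a) (R_v ^ Suc p * R_v)) * R_v ^ q"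
    by (simp add: lambda_e_def mult.assoc left_diff_distrib right_diff_distrib R.scale_mult_left R.scale_mult_right
         del: power_Suc)
  also have "\<dots> = R_u * R_v ^ Suc (p + q) - R_scale (of_nat (Suc p) + of_nat q * a) (R_v ^ Suc (Suc (p + q)))"
    unfolding R_vu
    by (simp add: left_diff_distrib mult.assoc R.scale_mult_left R.scale_left_distrib del: power_Suc of_nat_Suc)
  finally show ?thesis .
qed

text \<open>This is \<open>lambda_e_bracket\<close> differentiated in a: the \<epsilon>-part of the
  bracket relation over the dual numbers.\<close>

lemma lambda_e'_bracket:
  assumes "n \<ge> 1" "m \<ge> 1"
  shows "lambda_e' n * lambda_e a m + lambda_e a n * lambda_e' m
      - (lambda_e' m * lambda_e a n + lambda_e a m * lambda_e' n) =
    R_scale (of_nat m - of_nat n) (lambda_e' (n + m))"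
proof -
  obtain p where n: "n = Suc p" using assms(1) by (cases n) auto
  obtain q where m: "m = Suc q" using assms(2) by (cases m) auto
  define X Y where "X = (R_u * R_v ^ Suc (p + q) :: 'a jordan)" and "Y = (R_v ^ Suc (Suc (p + q)) :: 'a jordan)"
  have s: "lambda_e' n = - R_scale (of_nat p) (R_v ^ Suc p)"
    "lambda_e' m = - R_scale (of_nat q) (R_v ^ Suc q)"
    "lambda_e' (n + m) = - R_scale (of_nat (Suc (p + q))) Y"
    by (simp_all add: lambda_e'_def n m Y_def)
  have id: "P * (P + 1 + Q * a) + Q * (P * a) - Q * (Q + 1 + P * a) - P * (Q * a)
      = - ((Q - P) * (P + Q + 1))" for P Q
    by algebra
  have comb: "- R_scale P (X - R_scale b Y) + - R_scale Q (X - R_scale c Y)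
      - (- R_scale Q (X - R_scale d Y) + - R_scale P (X - R_scale e Y))
      = R_scale (P * b + Q * c - Q * d - P * e) Y" for P Q b c d e
    by (simp add: R.scale_right_diff_distrib R.scale_left_distrib R.scale_left_diff_distrib)
  have "lambda_e' n * lambda_e a m = - R_scale (of_nat p) (X - R_scale (of_nat p + 1 + of_nat q * a) Y)"
    "lambda_e a n * lambda_e' m = - R_scale (of_nat q) (X - R_scale (of_nat p * a) Y)"
    "lambda_e' m * lambda_e a n = - R_scale (of_nat q) (X - R_scale (of_nat q + 1 + of_nat p * a) Y)"
    "lambda_e a m * lambda_e' n = - R_scale (of_nat p) (X - R_scale (of_nat q * a) Y)"
    unfolding s unfolding n m mult_minus_left mult_minus_right R.scale_mult_left R.scale_mult_right
      v_mult_lambda_e lambda_e_mult_v X_def Y_def by (simp_all only: add.commute of_nat_Suc)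
  then have "lambda_e' n * lambda_e a m + lambda_e a n * lambda_e' m
      - (lambda_e' m * lambda_e a n + lambda_e a m * lambda_e' n)
    = R_scale (of_nat p * (of_nat p + 1 + of_nat q * a) + of_nat q * (of_nat p * a)
        - of_nat q * (of_nat q + 1 + of_nat p * a) - of_nat p * (of_nat q * a)) Y"
    by (simp only: comb)
  also have "\<dots> = R_scale (of_nat m - of_nat n) (lambda_e' (n + m))"
    unfolding id s(3) by (simp add: n m add.commute)
  finally show ?thesis .
qed

definition is_lambda_derivation :: "'k::field_char_0 \<Rightarrow> ('k U_witt \<Rightarrow> 'k jordan) \<Rightarrow> bool" where
  "is_lambda_derivation a D \<longleftrightarrow>
     (\<forall>x y. D (x + y) = D x + D y) \<and> (\<forall>c x. D (U_scale c x) = R_scale c (D x)) \<and>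
     (\<forall>x y. D (x * y) = D x * lambda_hom a y + lambda_hom a x * D y) \<and>
     (\<forall>n\<ge>1. D (U_e n) = lambda_e' n)"

text \<open>The universal property yields a homomorphism into the dual numbers. Its real part is
  \<open>lambda_hom a\<close> by uniqueness, so multiplicativity makes its \<epsilon>-part a
  derivation along \<open>lambda_hom a\<close>.\<close>

lemma ex_lambda_derivation: "\<exists>D. is_lambda_derivation (a :: 'k::field_char_0) D"
proof -
  define f where "f = lin_ext dual_scale (\<lambda>n. Dual (lambda_e a (nat_of n)) (lambda_e' (nat_of n)))"
  interpret f: Vector_Spaces.linear pm_scale dual_scale f
    unfolding f_def by (rule dual.lin_ext_linear)
  have br: "f (witt_bracket x y) = f x * f y - f y * f x" for x y
  proof (induction x rule: pm_induct)
    case (2 n c)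
    show ?case
    proof (induction y rule: pm_induct)
      case (2 m d)
      let ?n = "nat_of n" and ?m = "nat_of m"
      have "f (witt_bracket (Poly_Mapping.single n c) (Poly_Mapping.single m d))
        = dual_scale (c * d) (Dual (R_scale (of_nat ?m - of_nat ?n) (lambda_e a (?n + ?m)))
            (R_scale (of_nat ?m - of_nat ?n) (lambda_e' (?n + ?m))))"
        by (simp add: witt_bracket_single f_def dual_scale_def)
      also have "\<dots> = dual_scale (c * d)
          (Dual (lambda_e a ?n) (lambda_e' ?n) * Dual (lambda_e a ?m) (lambda_e' ?m)
           - Dual (lambda_e a ?m) (lambda_e' ?m) * Dual (lambda_e a ?n) (lambda_e' ?n))"
        unfolding lambda_e'_bracket[OF nat_of_ge_1[of n] nat_of_ge_1[of m], where a = a, symmetric]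
          lambda_e_bracket[OF nat_of_ge_1 nat_of_ge_1, symmetric]
        by (simp add: times_dual_def minus_dual_def)
      finally show ?case
        by (simp add: f_def dual.scale_mult_left dual.scale_mult_right dual.scale_right_diff_distrib mult.commute)
    qed (simp_all add: witt_bracket_bilinear f.add f.zero algebra_simps)
  qed (simp_all add: witt_bracket_bilinear f.add f.zero algebra_simps)
  obtain h where h: "algebra_hom U_scale dual_scale h" "\<And>x. h (U_incl x) = f x"
    using U_universal[OF dual.k_algebra_axioms f.linear_axioms br] by auto
  interpret h: Vector_Spaces.linear U_scale dual_scale h using h by (simp add: algebra_hom_def)
  have h_mult: "h (x * y) = h x * h y" and h_1: "h 1 = 1" for x y
    using h by (auto simp: algebra_hom_def)
  have e: "h (U_e n) = Dual (lambda_e a n) (lambda_e' n)" if "n \<ge> 1" for n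
    using that by (simp add: U_e_def h f_def witt_basis_def posnat_inverse)
  have "is_lambda a (\<lambda>x. re_part (h x))"
    unfolding is_lambda_def algebra_hom_def
    by (auto intro!: Vector_Spaces.linear.intro module_hom.intro
        module_hom_axioms.intro simp: U.module_axioms R.module_axioms U.vector_space_axioms R.vector_space_axioms
        h.add h.scale h_mult h_1 e)
  then have "re_part (h x) = lambda_hom a x" for x
    using ex1_lambda[of a] is_lambda_lambda_hom[of a] by metis
  then have "is_lambda_derivation a (\<lambda>x. eps_part (h x))"
    by (auto simp: is_lambda_derivation_def h.add h.scale h_mult e)
  then show ?thesis by blast
qed

section \<open>The kernel is not finitely generated on either side\<close>

text \<open>As a function of a, the image of \<open>shift_rel 1 q\<close> is q a (a - 1) v^(q+3);
  the right side is its derivative.\<close>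

lemma lambda_derivation_shift_rel_1:
  assumes "is_lambda_derivation a D"
  shows "D (shift_rel 1 q) = R_scale (of_nat q * (2 * a - 1)) (R_v ^ (q + 3))"
proof -
  have D: "D (x + y) = D x + D y" "D (U_scale c x) = R_scale c (D x)"
    "D (x * y) = D x * lambda_hom a y + lambda_hom a x * D y" for x y c
    using assms by (auto simp: is_lambda_derivation_def)
  have D_diff: "D (x - y) = D x - D y" for x y
    using D(1)[of "x - y" y] by (simp add: algebra_simps)
  have D_E: "D (U_E p) = - R_scale (of_nat p) (R_v ^ Suc p)" for p
    using assms by (auto simp: is_lambda_derivation_def U_E_def lambda_e'_def)
  define X Y where "X = (R_u * R_v ^ Suc (Suc q) :: 'a jordan)" and "Y = (R_v ^ (q + 3) :: 'a jordan)"
  have v: "R_v ^ Suc 1 * lambda_e a (Suc q) = X - R_scale (2 + of_nat q * a) Y"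
    "lambda_e a (Suc 1) * R_v ^ Suc q = X - R_scale a Y"
    "lambda_e a (Suc 0) * R_v ^ Suc (1 + q) = X"
    unfolding v_mult_lambda_e lambda_e_mult_v X_def Y_def by (simp_all add: numeral_3_eq_3)
  have "D (shift_rel 1 q) = - R_scale 1 (R_v ^ Suc 1 * lambda_e a (Suc q))
      + - R_scale (of_nat q) (lambda_e a (Suc 1) * R_v ^ Suc q)
      - - R_scale (of_nat (1 + q)) (lambda_e a (Suc 0) * R_v ^ Suc (1 + q))
      + - R_scale (of_nat (Suc (1 + q))) Y"
    by (simp add: shift_rel_def D D_diff D_E lambda_hom_U_E R.scale_mult_left R.scale_mult_right
        Y_def numeral_3_eq_3)
  also have "\<dots> = R_scale (of_nat q * (2 * a - 1)) Y"
  proof -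
    have comb: "- R_scale 1 (X - R_scale b Y) + - R_scale Q (X - R_scale c Y) - - R_scale (1 + Q) X + - R_scale d Y
        = R_scale (b + Q * c - d) Y" for Q b c d
    proof -
      have "- (x - y) + - (z - w) - - (x + z) + - t = y + w - t" for x y z w t :: "'a jordan"
        by simp
      then show ?thesis
        by (simp only: R.scale_right_diff_distrib R.scale_left_distrib R.scale_left_diff_distrib
            R.scale_scale R.scale_one mult_1_left)
    qed
    have "2 + Q * a + Q * a - (1 + (1 + Q)) = Q * (2 * a - 1)" for Q
      by algebra
    then show ?thesis unfolding v of_nat_Suc of_nat_add of_nat_1 comb by (rule arg_cong)
  qed
  finally show ?thesis by (simp add: Y_def)
qed

text \<open>Finitely many generators are all killed by \<open>\<phi> N\<close> for some large N, and
  then so is the whole ideal they generate.\<close>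

lemma not_finitely_generated:
  fixes \<phi> :: "nat \<Rightarrow> 'a \<Rightarrow> 'k::zero"
  assumes "\<And>x. finite {N. \<phi> N x \<noteq> 0}"
    and "\<And>N. P {x \<in> I. \<phi> N x = 0}"
    and "\<And>N. N \<ge> N0 \<Longrightarrow> \<exists>x\<in>I. \<phi> N x \<noteq> 0"
  shows "\<not> (\<exists>S. finite S \<and> I = P hull S)"
proof safe
  fix S assume S: "finite S" and I: "I = P hull S"
  have "finite ({..<N0} \<union> (\<Union>x\<in>S. {N. \<phi> N x \<noteq> 0}))" using S assms(1) by simp
  then obtain N where "N \<notin> {..<N0} \<union> (\<Union>x\<in>S. {N. \<phi> N x \<noteq> 0})"
    using ex_new_if_finite infinite_UNIV_nat by blast
  then have N: "N \<ge> N0" "\<And>x. x \<in> S \<Longrightarrow> \<phi> N x = 0" by auto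
  have "S \<subseteq> I" unfolding I by (rule hull_subset)
  then have "P hull S \<subseteq> {x \<in> I. \<phi> N x = 0}" using N(2) assms(2) by (intro hull_minimal) auto
  then show False using assms(3)[OF N(1)] I by auto
qed

text \<open>Each \<lambda>_0(E_p) = u v^p sends z into u R, where pure powers of v have coefficient
  0.\<close>

lemma lookup_lambda_0_mult:
  assumes "Poly_Mapping.lookup (R_coeffs z) (0, N) = 0"
  shows "Poly_Mapping.lookup (R_coeffs (lambda_hom 0 x * z)) (0, N) = 0"
  using assms
proof (induction x arbitrary: z rule: U_induct_E)
  case (2 p)
  have "lambda_hom 0 (U_E p) * z = R_u * (R_v ^ p * z)"
    by (simp add: lambda_hom_U_E lambda_e_Suc mult.assoc)
  then show ?case by (simp add: lookup_R_coeffs_u_mult)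
qed (simp_all add: lambda_hom_1 lambda_hom_mult lambda_hom_add lambda_hom_scale distrib_right
    R.scale_mult_left mult.assoc R_coeffs_add R_coeffs_scale lookup_add)

text \<open>The mirror image: \<lambda>_1(E_p) = (u - p v) v^p = v^p u lies in R u, which is why the
  right side uses a = 1.\<close>

lemma right_weight_mult_lambda_1:
  assumes "right_weight N z = 0"
  shows "right_weight N (z * lambda_hom 1 x) = 0"
  using assms
proof (induction x arbitrary: z rule: U_induct_E)
  case (2 p)
  have "z * lambda_hom 1 (U_E p) = (z * R_v ^ p) * R_u"
    by (simp add: lambda_hom_U_E lambda_e_Suc mult.assoc R_vu)
  then show ?case by (simp only: right_weight_mult_u)
next
  case (3 x y)
  then show ?case by (simp add: lambda_hom_mult flip: mult.assoc)
qed (simp_all add: lambda_hom_1 lambda_hom_add lambda_hom_scale distrib_left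
    R.scale_mult_right right_weight_add right_weight_scale)

lemma not_fg_left_r_ideal: "\<not> fg_left_ideal (r_ideal :: 'k::field_char_0 U_witt set)"
proof -
  obtain D where D: "is_lambda_derivation (0 :: 'k) D" using ex_lambda_derivation by blast
  define \<phi> where "\<phi> N x = Poly_Mapping.lookup (R_coeffs (D x)) (0, N)" for N x
  have ker: "x \<in> r_ideal \<longleftrightarrow> lambda_hom 0 x = 0" for x :: "'k U_witt"
    using kernel_lambda_0 by blast
  show ?thesis
    unfolding fg_left_ideal_def
  proof (rule not_finitely_generated[where \<phi> = \<phi> and ?N0.0 = 4])
    show "finite {N. \<phi> N x \<noteq> 0}" for x
      unfolding \<phi>_def by (rule finite_lookup_R_coeffs)
    show "left_ideal {x \<in> r_ideal. \<phi> N x = 0}" for N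
      unfolding left_ideal_def
    proof (intro conjI ballI allI)
      have "D 0 = 0" using D R.scale_zero_left U.scale_zero_left by (metis is_lambda_derivation_def)
      then show "0 \<in> {x \<in> r_ideal. \<phi> N x = 0}" by (simp add: r_ideal_0 \<phi>_def R_coeffs_0)
    next
      fix x y assume "x \<in> {x \<in> r_ideal. \<phi> N x = 0}" "y \<in> {x \<in> r_ideal. \<phi> N x = 0}"
      then show "x + y \<in> {x \<in> r_ideal. \<phi> N x = 0}"
        using D by (simp add: is_lambda_derivation_def r_ideal_add \<phi>_def R_coeffs_add lookup_add)
    next
      fix x b assume x: "x \<in> {x \<in> r_ideal. \<phi> N x = 0}"
      \<comment> \<open>The other Leibniz term contains \<lambda>_0(x) = 0.\<close>
      then have "D (b * x) = lambda_hom 0 b * D x" using D by (simp add: is_lambda_derivation_def ker)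
      then show "b * x \<in> {x \<in> r_ideal. \<phi> N x = 0}"
        using x by (simp add: r_ideal_mult_left \<phi>_def lookup_lambda_0_mult)
    qed
  next
    fix N :: nat assume "4 \<le> N"
    \<comment> \<open>The power v^(q+3) is reached only with q > 0, since its coefficient is a
      multiple of q; hence the bound 4.\<close>
    then have "N = (N - 3) + 3" "N - 3 \<noteq> 0" by auto
    then obtain q where q: "N = q + 3" "q \<noteq> 0" by blast
    have "R_coeffs (R_v ^ N :: 'k jordan) = Poly_Mapping.single (0, N) 1"
      using R_coeffs_monom[of 0 N] by simp
    then have "R_coeffs (D (shift_rel 1 q)) = pm_scale (of_nat q * (2 * 0 - 1)) (Poly_Mapping.single (0, N) 1)"
      by (simp only: lambda_derivation_shift_rel_1[OF D] R_coeffs_scale q(1))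
    then have "\<phi> N (shift_rel 1 q) \<noteq> 0" using q(2) by (simp add: \<phi>_def)
    then show "\<exists>x\<in>r_ideal. \<phi> N x \<noteq> 0" using shift_rel_in_r_ideal by blast
  qed
qed

lemma not_fg_right_r_ideal: "\<not> fg_right_ideal (r_ideal :: 'k::field_char_0 U_witt set)"
proof -
  obtain D where D: "is_lambda_derivation (1 :: 'k) D" using ex_lambda_derivation by blast
  define \<phi> where "\<phi> N x = right_weight N (D x)" for N x
  have ker: "x \<in> r_ideal \<longleftrightarrow> lambda_hom 1 x = 0" for x :: "'k U_witt"
    using kernel_lambda_1 by blast
  have 0: "right_weight N 0 = (0 :: 'k)" for N using right_weight_scale[of N 0 0] by simp
  show ?thesis
    unfolding fg_right_ideal_def
  proof (rule not_finitely_generated[where \<phi> = \<phi> and ?N0.0 = 4])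
    show "finite {N. \<phi> N x \<noteq> 0}" for x
      unfolding \<phi>_def by (rule finite_right_weight)
    show "right_ideal {x \<in> r_ideal. \<phi> N x = 0}" for N
      unfolding right_ideal_def
    proof (intro conjI ballI allI)
      have "D 0 = 0" using D R.scale_zero_left U.scale_zero_left by (metis is_lambda_derivation_def)
      then show "0 \<in> {x \<in> r_ideal. \<phi> N x = 0}" by (simp add: r_ideal_0 \<phi>_def 0)
    next
      fix x y assume "x \<in> {x \<in> r_ideal. \<phi> N x = 0}" "y \<in> {x \<in> r_ideal. \<phi> N x = 0}"
      then show "x + y \<in> {x \<in> r_ideal. \<phi> N x = 0}"
        using D by (simp add: is_lambda_derivation_def r_ideal_add \<phi>_def right_weight_add)
    next
      fix x b assume x: "x \<in> {x \<in> r_ideal. \<phi> N x = 0}"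
      \<comment> \<open>The other Leibniz term contains \<lambda>_1(x) = 0.\<close>
      then have "D (x * b) = D x * lambda_hom 1 b" using D by (simp add: is_lambda_derivation_def ker)
      then show "x * b \<in> {x \<in> r_ideal. \<phi> N x = 0}"
        using x by (simp add: r_ideal_mult_right \<phi>_def right_weight_mult_lambda_1)
    qed
  next
    fix N :: nat assume "4 \<le> N"
    then have "N = (N - 3) + 3" "N - 3 \<noteq> 0" by auto
    then obtain q where q: "N = q + 3" "q \<noteq> 0" by blast
    have "right_weight N (R_v ^ N) = (1 :: 'k)" by (rule right_weight_v)
    then have "\<phi> N (shift_rel 1 q) \<noteq> 0"
      using q by (simp add: \<phi>_def lambda_derivation_shift_rel_1[OF D] right_weight_scale del: One_nat_def)
    then show "\<exists>x\<in>r_ideal. \<phi> N x \<noteq> 0" using shift_rel_in_r_ideal by blast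
  qed
qed

theorem theorem0p7:
  fixes I :: "'k::field_char_0 U_witt set"
  assumes "I = two_sided_ideal hull {U_e 1 * U_e 3 - U_e 2 ^ 2 - U_e 4}"
  shows "{x. lambda_hom (0::'k) x = 0} = I \<and> {x. lambda_hom (1::'k) x = 0} = I \<and>
         \<not> fg_left_ideal I \<and> \<not> fg_right_ideal I"
proof -
  have "I = r_ideal" using assms by (simp add: r_ideal_def)
  then show ?thesis
    using kernel_lambda_0 kernel_lambda_1 not_fg_left_r_ideal not_fg_right_r_ideal by metis
qed

end
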